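(* Let $0<r_1<r_2$, $A(r_1,r_2)=\{x\in\mathbb{R}^n:r_1<|x|<r_2\}$, and let $p(x)=p(|x|)$ be radial and measurable with $1<p^-\le p(r)\le p^+<\infty$. Let $\Gamma$ be the family of locally rectifiable curves joining $S^{n-1}_{r_1}$ and $S^{n-1}_{r_2}$ inside $A(r_1,r_2)$. Then $$\mathrm{M}_{p(\cdot)}(\Gamma)=\inf_\varphi\ \omega_{n-1}\int_{r_1}^{r_2}\varphi(r)^{p(r)}\,r^{n-1}\,dr,$$ where the infimum is over all measurable $\varphi\colon[r_1,r_2]\to[0,\infty)$ with $\int_{r_1}^{r_2}\varphi(r)\,dr\ge1$. Moreover, the infimum is attained by a unique minimizer (equivalently, a unique radial extremal density).
   Context: $S^{n-1}_r=\{x\in\mathbb{R}^n:|x|=r\}$; $\omega_{n-1}$ is the surface measure of the unit sphere in $\mathbb{R}^n$. A density $\rho\colon\mathbb{R}^n\to[0,\infty]$ is admissible for a curve family $\Gamma$ if it is Borel and $\int_\gamma\rho\,ds\ge1$ for every locally rectifiable $\gamma\in\Gamma$. The $p(\cdot)$-modulus is $\mathrm{M}_{p(\cdot)}(\Gamma)=\inf_\rho\int_{A(r_1,r_2)}\rho(x)^{p(x)}dx$ over admissible $\rho$. *)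

theory Defs
  imports "HOL-Analysis.Analysis"
begin

definition annulus :: "real \<Rightarrow> real \<Rightarrow> 'a::euclidean_space set" where
  "annulus r1 r2 = {x. r1 < norm x \<and> norm x < r2}"

definition curve_var :: "(real \<Rightarrow> 'a::euclidean_space) \<Rightarrow> real \<Rightarrow> real \<Rightarrow> ennreal" where
  "curve_var g a b =
     (SUP ts \<in> {ts. sorted ts \<and> set ts \<subseteq> {a..b}}.
        (\<Sum>i < length ts - 1. ennreal (dist (g (ts ! i)) (g (ts ! Suc i)))))"

text \<open>A closed curve parametrised on [0,1] is (locally) rectifiable iff its length is finite.\<close>
definition rectifiable_curve :: "(real \<Rightarrow> 'a::euclidean_space) \<Rightarrow> bool" where
  "rectifiable_curve g \<longleftrightarrow> path g \<and> curve_var g 0 1 < \<infinity>"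

definition arclen :: "(real \<Rightarrow> 'a::euclidean_space) \<Rightarrow> real \<Rightarrow> real" where
  "arclen g t = enn2real (curve_var g 0 (min t 1))"

definition line_integral :: "('a::euclidean_space \<Rightarrow> ennreal) \<Rightarrow> (real \<Rightarrow> 'a) \<Rightarrow> ennreal" where
  "line_integral \<rho> g = (\<integral>\<^sup>+ t. \<rho> (g t) * indicator {0..1} t \<partial>interval_measure (arclen g))"

definition joining_family :: "real \<Rightarrow> real \<Rightarrow> (real \<Rightarrow> 'a::euclidean_space) set" where
  "joining_family r1 r2 =
     {g. path g \<and>
         ((g 0 \<in> sphere 0 r1 \<and> g 1 \<in> sphere 0 r2) \<or> (g 0 \<in> sphere 0 r2 \<and> g 1 \<in> sphere 0 r1)) \<and>
         (\<forall>t \<in> {0<..<1}. g t \<in> annulus r1 r2)}"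

definition admissible :: "('a::euclidean_space \<Rightarrow> ennreal) \<Rightarrow> (real \<Rightarrow> 'a) set \<Rightarrow> bool" where
  "admissible \<rho> \<Gamma> \<longleftrightarrow> \<rho> \<in> borel_measurable borel \<and>
     (\<forall>g \<in> \<Gamma>. rectifiable_curve g \<longrightarrow> line_integral \<rho> g \<ge> 1)"

definition epow :: "ennreal \<Rightarrow> real \<Rightarrow> ennreal" where
  "epow x a = (if x = \<infinity> then \<infinity> else ennreal (enn2real x powr a))"

definition var_modulus :: "('a::euclidean_space \<Rightarrow> real) \<Rightarrow> 'a set \<Rightarrow> (real \<Rightarrow> 'a) set \<Rightarrow> ennreal" where
  "var_modulus p D \<Gamma> =
     (INF \<rho> \<in> {\<rho>. admissible \<rho> \<Gamma>}. \<integral>\<^sup>+ x. epow (\<rho> x) (p x) * indicator D x \<partial>lebesgue)"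

text \<open>Surface measure of the unit sphere in R^n.\<close>
definition omega :: "nat \<Rightarrow> real" where
  "omega n = 2 * pi powr (real n / 2) / Gamma (real n / 2)"

definition radial_class :: "real \<Rightarrow> real \<Rightarrow> (real \<Rightarrow> real) set" where
  "radial_class r1 r2 = {\<phi>. \<phi> \<in> borel_measurable (lebesgue_on {r1..r2}) \<and>
       (\<forall>r \<in> {r1..r2}. 0 \<le> \<phi> r) \<and>
       (\<integral>\<^sup>+ r. ennreal (\<phi> r) \<partial>lebesgue_on {r1..r2}) \<ge> 1}"

definition radial_energy :: "nat \<Rightarrow> (real \<Rightarrow> real) \<Rightarrow> real \<Rightarrow> real \<Rightarrow> (real \<Rightarrow> real) \<Rightarrow> ennreal" where
  "radial_energy n p r1 r2 \<phi> =
     ennreal (omega n) * (\<integral>\<^sup>+ r. ennreal (\<phi> r powr p r * r ^ (n - 1)) \<partial>lebesgue_on {r1..r2})"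

end

theory Submission
  imports Defs "HOL-Probability.Distribution_Functions"
begin

text \<open>The Euler--Lagrange equation of the radial problem, \<open>p r * \<phi> r powr (p r - 1) * r ^ (n - 1) = L\<close>,
  can be solved pointwise for \<open>\<phi>\<close>, and the multiplier \<open>L\<close> is fixed by \<open>\<integral> \<phi> = 1\<close>. The tangent line of
  \<open>t powr p\<close> at \<open>\<phi> r\<close> then gives, with weight \<open>w x = L / norm x ^ (n - 1)\<close>, the pointwise inequality
  \<open>\<phi> powr p + w * \<rho> \<le> \<rho> powr p + w * \<phi>\<close>, strict unless \<open>\<rho> = \<phi>\<close>. Every admissible \<open>\<rho>\<close> has
  integral at least 1 along each radial segment, so \<open>\<integral> w * \<rho> \<ge> L * \<omega> = \<integral> w * \<phi>\<close> by polar
  coordinates, whence the energy of \<open>\<rho>\<close> is at least that of \<open>\<phi>\<close>; the same inequality on the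
  interval gives minimality and uniqueness of \<open>\<phi>\<close> among radial densities. Conversely
  \<open>\<phi> (norm x)\<close> is admissible, because \<open>norm\<close> does not increase lengths and so pushes the
  arc length measure of a joining curve to a measure that dominates Lebesgue measure on the interval.\<close>

section \<open>Polar coordinates\<close>

lemma nn_integral_lborel_scaleR:
  fixes f :: "'a::euclidean_space \<Rightarrow> ennreal"
  assumes [measurable]: "f \<in> borel_measurable borel" and c: "0 < c"
  shows "(\<integral>\<^sup>+x. f (c *\<^sub>R x) \<partial>lborel) = ennreal (1 / c ^ DIM('a)) * (\<integral>\<^sup>+x. f x \<partial>lborel)"
proof -
  have "(\<integral>\<^sup>+x. f x \<partial>lborel) = (\<integral>\<^sup>+x. f x \<partial>density (distr lborel borel (\<lambda>x. 0 + c *\<^sub>R x)) (\<lambda>_. \<bar>c\<bar>^DIM('a)))"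
    using c by (subst lborel_affine[of c 0]) auto
  also have "\<dots> = ennreal (c^DIM('a)) * (\<integral>\<^sup>+x. f (c *\<^sub>R x) \<partial>lborel)"
    using c by (simp add: nn_integral_density nn_integral_distr nn_integral_cmult)
  finally show ?thesis
    using c by (simp add: mult.assoc[symmetric] flip: ennreal_mult)
qed

text \<open>This is the integration over the dilation parameter in the polar coordinate formula; the
  antiderivative \<open>- 1 / (n * s ^ n)\<close> vanishes at infinity.\<close>

lemma nn_integral_tail_power:
  fixes a :: real
  assumes "0 < a" "0 < n"
  shows "(\<integral>\<^sup>+s. ennreal (1 / s ^ Suc n) * indicator {a<..} s \<partial>lborel) = ennreal (1 / (real n * a ^ n))"
proof -
  have "(\<integral>\<^sup>+s. ennreal (1 / s ^ Suc n) * indicator {a<..} s \<partial>lborel)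
      = (\<integral>\<^sup>+s. ennreal (1 / s ^ Suc n) * indicator {a..} s \<partial>lborel)"
    by (rule nn_integral_cong_AE, rule AE_mp[OF AE_lborel_singleton[of a]], rule AE_I2)
       (auto split: split_indicator)
  also have "\<dots> = ennreal (0 - (- 1 / (real n * a ^ n)))"
  proof (rule nn_integral_FTC_atLeast)
    fix x :: real assume "a \<le> x"
    then have x: "x > 0" using assms by simp
    have n: "x ^ n = x ^ (n - 1) * x"
      using assms by (cases n) auto
    show "DERIV (\<lambda>x. - 1 / (real n * x ^ n)) x :> 1 / x ^ Suc n"
      using x assms
      by (auto intro!: derivative_eq_intros simp: field_simps power2_eq_square n power_add)
  next
    show "((\<lambda>x::real. - 1 / (real n * x ^ n)) \<longlongrightarrow> 0) at_top"
      using assms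
      by (intro tendsto_divide_0[OF tendsto_const] filterlim_at_top_imp_at_infinity
            filterlim_tendsto_pos_mult_at_top[OF tendsto_const] filterlim_pow_at_top filterlim_ident) auto
  qed (use assms in auto)
  finally show ?thesis by simp
qed

text \<open>The solid unit ball stands in for the sphere: a direction is
  \<open>y /\<^sub>R norm y\<close> with \<open>y\<close> in \<open>ball 0 1\<close>. Substituting
  \<open>r = s * norm y\<close>, exchanging the integrals, substituting
  \<open>x = s *\<^sub>R y\<close> and integrating over \<open>s > norm x\<close> leaves the weight
  \<open>1 / (DIM('a) * norm x ^ (DIM('a) - 1))\<close>.\<close>

lemma nn_integral_annulus_polar:
  fixes f :: "'a::euclidean_space \<Rightarrow> ennreal"
  assumes [measurable]: "f \<in> borel_measurable borel" and r: "0 < r1"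
  shows "(\<integral>\<^sup>+x. f x * ennreal (1 / norm x ^ (DIM('a) - 1)) * indicator (annulus r1 r2) x \<partial>lborel)
     = of_nat DIM('a) * (\<integral>\<^sup>+y. (\<integral>\<^sup>+r. f (r *\<^sub>R (y /\<^sub>R norm y)) * indicator {r1<..<r2} r \<partial>lborel)
           * indicator (ball 0 1) (y::'a) \<partial>lborel)"
proof -
  \<comment> \<open>\<open>K\<close> is the integrand after \<open>x = s *\<^sub>R y\<close>: the
    factor \<open>norm y = norm x / s\<close> and the Jacobian \<open>1 / s ^ DIM('a)\<close>
    combine to \<open>norm x / s ^ Suc DIM('a)\<close>, and \<open>norm y < 1\<close> becomes
    \<open>norm x < s\<close>.\<close>
  define K where "K s x = f x * ennreal (norm x) * indicator (annulus r1 r2) x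
      * (ennreal (1 / s ^ Suc DIM('a)) * indicator {0<..} (s - norm x))" for s :: real and x :: 'a
  have [measurable]: "annulus r1 r2 \<in> sets (borel :: 'a measure)"
    unfolding annulus_def by measurable
  have [measurable]: "Measurable.pred borel (\<lambda>y::'a. y \<in> ball 0 1)" "{0<..} \<in> sets (borel :: real measure)"
    by auto
  have [measurable]: "case_prod K \<in> borel_measurable (lborel \<Otimes>\<^sub>M lborel)"
    unfolding K_def by measurable
  have "(\<integral>\<^sup>+y. (\<integral>\<^sup>+r. f (r *\<^sub>R (y /\<^sub>R norm y)) * indicator {r1<..<r2} r \<partial>lborel)
           * indicator (ball 0 1) (y::'a) \<partial>lborel)
     = (\<integral>\<^sup>+y. (\<integral>\<^sup>+s. f (s *\<^sub>R y) * ennreal (norm y) * indicator (annulus r1 r2) (s *\<^sub>R y)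
           * indicator (ball 0 1) y * indicator {0<..} s \<partial>lborel) \<partial>lborel)"
  proof (rule nn_integral_cong_AE, rule AE_mp[OF AE_lborel_singleton[of 0]], rule AE_I2, rule impI)
    fix y :: 'a assume y: "y \<noteq> 0"
    \<comment> \<open>Membership of \<open>s *\<^sub>R y\<close> in the annulus depends only on the
      absolute value of \<open>s\<close>, so \<open>indicator {0<..} s\<close> has to exclude
      negative \<open>s\<close>; it loses nothing, because \<open>r1 < s * norm y\<close> forces
      \<open>s\<close> to be positive.\<close>
    have pos: "0 < s" if "r1 < s * norm y" for s
      using that r y by (metis less_trans zero_less_mult_pos2 zero_less_norm_iff)
    have "(\<integral>\<^sup>+r. f (r *\<^sub>R (y /\<^sub>R norm y)) * indicator {r1<..<r2} r \<partial>lborel) =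
        norm y * (\<integral>\<^sup>+s. f ((0 + norm y * s) *\<^sub>R (y /\<^sub>R norm y)) * indicator {r1<..<r2} (0 + norm y * s) \<partial>lborel)"
      using y by (subst nn_integral_real_affine[of _ "norm y" 0]) auto
    also have "\<dots> = (\<integral>\<^sup>+s. f (s *\<^sub>R y) * ennreal (norm y) * indicator (annulus r1 r2) (s *\<^sub>R y)
           * indicator {0<..} s \<partial>lborel)"
    proof (subst nn_integral_cmult[symmetric], measurable, rule nn_integral_cong)
      fix s :: real
      show "ennreal (norm y) * (f ((0 + norm y * s) *\<^sub>R (y /\<^sub>R norm y)) * indicator {r1<..<r2} (0 + norm y * s))
        = f (s *\<^sub>R y) * ennreal (norm y) * indicator (annulus r1 r2) (s *\<^sub>R y) * indicator {0<..} s"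
        using y pos[of s] by (cases "0 < s") (auto simp: annulus_def mult_ac split: split_indicator)
    qed
    finally show "(\<integral>\<^sup>+r. f (r *\<^sub>R (y /\<^sub>R norm y)) * indicator {r1<..<r2} r \<partial>lborel) * indicator (ball 0 1) y
       = (\<integral>\<^sup>+s. f (s *\<^sub>R y) * ennreal (norm y) * indicator (annulus r1 r2) (s *\<^sub>R y)
           * indicator (ball 0 1) y * indicator {0<..} s \<partial>lborel)"
      by (auto split: split_indicator)
  qed
  also have "\<dots> = (\<integral>\<^sup>+s. (\<integral>\<^sup>+y. f (s *\<^sub>R y) * ennreal (norm y) * indicator (annulus r1 r2) (s *\<^sub>R y)
           * indicator (ball 0 1) y * indicator {0<..} s \<partial>lborel) \<partial>lborel)"
    by (rule lborel_pair.Fubini') measurable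
  also have "\<dots> = (\<integral>\<^sup>+s. (\<integral>\<^sup>+x. K s x \<partial>lborel) \<partial>lborel)"
  proof (rule nn_integral_cong)
    fix s :: real
    show "(\<integral>\<^sup>+y. f (s *\<^sub>R y) * ennreal (norm y) * indicator (annulus r1 r2) (s *\<^sub>R y)
           * indicator (ball 0 1) (y::'a) * indicator {0<..} s \<partial>lborel) = (\<integral>\<^sup>+x. K s x \<partial>lborel)"
    proof (cases "0 < s")
      case False
      have "K s x = 0" for x
      proof -
        have "\<not> norm x < s" using False norm_ge_zero[of x] by linarith
        then show ?thesis by (simp add: K_def)
      qed
      with False show ?thesis by simp
    next
      case s: True
      let ?g = "\<lambda>x::'a. f x * ennreal (norm x / s) * indicator (annulus r1 r2) x * indicator {0<..} (s - norm x)"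
      have "(\<integral>\<^sup>+y. f (s *\<^sub>R y) * ennreal (norm y) * indicator (annulus r1 r2) (s *\<^sub>R y)
           * indicator (ball 0 1) (y::'a) * indicator {0<..} s \<partial>lborel) = (\<integral>\<^sup>+y. ?g (s *\<^sub>R y) \<partial>lborel)"
        using s by (intro nn_integral_cong) (auto split: split_indicator)
      also have "\<dots> = ennreal (1 / s ^ DIM('a)) * (\<integral>\<^sup>+x. ?g x \<partial>lborel)"
        using s by (intro nn_integral_lborel_scaleR) auto
      also have "\<dots> = (\<integral>\<^sup>+x. K s x \<partial>lborel)"
        using s
        apply (subst nn_integral_cmult[symmetric], measurable)
        apply (intro nn_integral_cong)
        apply (simp add: K_def ennreal_mult'' divide_ennreal[symmetric] mult_ac divide_inverse split: split_indicator)
        done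
      finally show ?thesis .
    qed
  qed
  also have "\<dots> = (\<integral>\<^sup>+x. (\<integral>\<^sup>+s. K s x \<partial>lborel) \<partial>lborel)"
    by (rule lborel_pair.Fubini') measurable
  also have "\<dots> = (\<integral>\<^sup>+x. ennreal (1 / DIM('a)) * (f x * ennreal (1 / norm x ^ (DIM('a) - 1)) * indicator (annulus r1 r2) x) \<partial>lborel)"
  proof (rule nn_integral_cong)
    fix x :: 'a
    have "(\<integral>\<^sup>+s. K s x \<partial>lborel) = f x * ennreal (norm x) * indicator (annulus r1 r2) x
      * (\<integral>\<^sup>+s. ennreal (1 / s ^ Suc DIM('a)) * indicator {norm x<..} s \<partial>lborel)"
      unfolding K_def by (subst nn_integral_cmult[symmetric]) (auto simp: indicator_def)
    also have "\<dots> = ennreal (1 / DIM('a)) * (f x * ennreal (1 / norm x ^ (DIM('a) - 1)) * indicator (annulus r1 r2) x)"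
    proof (cases "x \<in> annulus r1 r2")
      case True
      then have x: "norm x > 0" using r by (auto simp: annulus_def)
      have "norm x ^ DIM('a) = norm x * norm x ^ (DIM('a) - 1)"
        by (metis DIM_positive power_eq_if less_irrefl)
      then have "norm x * (1 / (DIM('a) * norm x ^ DIM('a))) = 1 / DIM('a) * (1 / norm x ^ (DIM('a) - 1))"
        using x by (simp add: field_simps)
      then have "ennreal (norm x) * ennreal (1 / (DIM('a) * norm x ^ DIM('a)))
          = ennreal (1 / DIM('a)) * ennreal (1 / norm x ^ (DIM('a) - 1))"
        using x by (simp flip: ennreal_mult)
      then show ?thesis
        using x True by (subst nn_integral_tail_power) (auto simp: mult_ac)
    qed simp
    finally show "(\<integral>\<^sup>+s. K s x \<partial>lborel) =
      ennreal (1 / DIM('a)) * (f x * ennreal (1 / norm x ^ (DIM('a) - 1)) * indicator (annulus r1 r2) x)" .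
  qed
  also have "\<dots> = ennreal (1 / DIM('a)) * (\<integral>\<^sup>+x. f x * ennreal (1 / norm x ^ (DIM('a) - 1)) * indicator (annulus r1 r2) x \<partial>lborel)"
    by (rule nn_integral_cmult) measurable
  finally show ?thesis
    by (simp add: mult.assoc[symmetric] ennreal_of_nat_eq_real_of_nat flip: ennreal_mult)
qed

lemma omega_pos: "0 < n \<Longrightarrow> 0 < omega n"
  by (simp add: omega_def)

text \<open>The functional equation of Gamma turns the surface area formula into the dimension times
  the volume of the unit ball, which is the constant that the polar formula produces for radial
  integrands.\<close>

lemma omega_eq_ball:
  "ennreal (omega DIM('a)) = of_nat DIM('a) * emeasure lborel (ball (0::'a::euclidean_space) 1)"
proof -
  have "Gamma (DIM('a) / 2 + 1) = DIM('a) / 2 * Gamma (DIM('a) / 2)"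
    by (rule Gamma_plus1) (auto dest!: nonpos_Ints_nonpos)
  then have "omega DIM('a) = DIM('a) * unit_ball_vol DIM('a)"
    unfolding omega_def unit_ball_vol_def by (subst \<open>Gamma _ = _\<close>) simp
  then show ?thesis
    by (simp add: emeasure_ball ennreal_mult ennreal_of_nat_eq_real_of_nat)
qed

text \<open>For the integrand \<open>f (norm x) * norm x ^ (DIM('a) - 1)\<close> the inner integral
  of the polar formula is the same in every direction, so the outer integral contributes only the
  volume of the ball.\<close>

lemma nn_integral_annulus_radial:
  fixes f :: "real \<Rightarrow> ennreal"
  assumes [measurable]: "f \<in> borel_measurable borel" and r: "0 < r1"
  shows "(\<integral>\<^sup>+x. f (norm x) * indicator (annulus r1 r2) (x::'a::euclidean_space) \<partial>lborel)
     = ennreal (omega DIM('a)) * (\<integral>\<^sup>+r. f r * ennreal (r ^ (DIM('a) - 1)) * indicator {r1<..<r2} r \<partial>lborel)"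
proof -
  let ?n = "DIM('a) - 1"
  let ?I = "\<integral>\<^sup>+r. f r * ennreal (r ^ ?n) * indicator {r1<..<r2} r \<partial>lborel"
  have "(\<integral>\<^sup>+x. f (norm x) * indicator (annulus r1 r2) (x::'a) \<partial>lborel)
      = (\<integral>\<^sup>+x. (f (norm x) * ennreal (norm x ^ ?n)) * ennreal (1 / norm x ^ ?n)
            * indicator (annulus r1 r2) (x::'a) \<partial>lborel)"
    using r by (intro nn_integral_cong)
      (auto simp: annulus_def mult.assoc simp flip: ennreal_mult split: split_indicator)
  also have "\<dots> = of_nat DIM('a) * (\<integral>\<^sup>+y. (\<integral>\<^sup>+r. f (norm (r *\<^sub>R (y /\<^sub>R norm y))) * ennreal (norm (r *\<^sub>R (y /\<^sub>R norm y)) ^ ?n)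
           * indicator {r1<..<r2} r \<partial>lborel) * indicator (ball 0 1) (y::'a) \<partial>lborel)"
    using r by (intro nn_integral_annulus_polar) auto
  also have "(\<integral>\<^sup>+y. (\<integral>\<^sup>+r. f (norm (r *\<^sub>R (y /\<^sub>R norm y))) * ennreal (norm (r *\<^sub>R (y /\<^sub>R norm y)) ^ ?n)
           * indicator {r1<..<r2} r \<partial>lborel) * indicator (ball 0 1) (y::'a) \<partial>lborel)
      = (\<integral>\<^sup>+y. ?I * indicator (ball 0 1) (y::'a) \<partial>lborel)"
  proof (rule nn_integral_cong_AE, rule AE_mp[OF AE_lborel_singleton[of 0]], rule AE_I2, rule impI)
    fix y :: 'a assume "y \<noteq> 0"
    then have "(\<integral>\<^sup>+r. f (norm (r *\<^sub>R (y /\<^sub>R norm y))) * ennreal (norm (r *\<^sub>R (y /\<^sub>R norm y)) ^ ?n)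
           * indicator {r1<..<r2} r \<partial>lborel) = ?I"
      using r by (intro nn_integral_cong) (simp add: abs_mult mult.assoc split: split_indicator)
    then show "(\<integral>\<^sup>+r. f (norm (r *\<^sub>R (y /\<^sub>R norm y))) * ennreal (norm (r *\<^sub>R (y /\<^sub>R norm y)) ^ ?n)
           * indicator {r1<..<r2} r \<partial>lborel) * indicator (ball 0 1) y = ?I * indicator (ball 0 1) y"
      by simp
  qed
  also have "\<dots> = ?I * emeasure lborel (ball (0::'a) 1)"
    by (rule nn_integral_cmult_indicator) simp
  finally show ?thesis
    by (simp add: omega_eq_ball mult_ac)
qed

section \<open>Arc length\<close>

text \<open>The length of an inscribed polygon, real-valued and recursive on the vertex list so that
  list induction replaces manipulation of indexed sums.\<close>

fun polysum :: "(real \<Rightarrow> 'a::metric_space) \<Rightarrow> real list \<Rightarrow> real" where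
  "polysum g (x # y # zs) = dist (g x) (g y) + polysum g (y # zs)"
| "polysum g _ = 0"

lemma polysum_nonneg: "0 \<le> polysum g ts"
  by (induction g ts rule: polysum.induct) auto

lemma polysum_eq_sum:
  "ennreal (polysum g ts) = (\<Sum>i < length ts - 1. ennreal (dist (g (ts ! i)) (g (ts ! Suc i))))"
proof (induction g ts rule: polysum.induct)
  case (1 g x y zs)
  have "(\<Sum>i < length (x # y # zs) - 1. ennreal (dist (g ((x # y # zs) ! i)) (g ((x # y # zs) ! Suc i))))
     = ennreal (dist (g x) (g y)) + (\<Sum>i < length (y # zs) - 1. ennreal (dist (g ((y # zs) ! i)) (g ((y # zs) ! Suc i))))"
    by (simp add: sum.lessThan_Suc_shift del: sum.lessThan_Suc)
  with 1 show ?case by (simp add: polysum_nonneg)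
qed auto

lemma polysum_append: "polysum g xs + polysum g ys \<le> polysum g (xs @ ys)"
proof (induction g xs rule: polysum.induct)
  case ("2_2" g v)
  then show ?case by (cases ys) auto
qed auto

text \<open>The edge joining \<open>xs\<close> to \<open>ys\<close> is replaced by the detour
  through \<open>u\<close> and \<open>v\<close>, which is no shorter by the triangle
  inequality.\<close>

lemma polysum_append_le:
  "polysum g (xs @ ys) \<le> polysum g (xs @ [u]) + dist (g u) (g v) + polysum g (v # ys)"
proof (induction g xs rule: polysum.induct)
  case ("2_1" g)
  show ?case by (cases ys) (auto simp: polysum_nonneg)
next
  case ("2_2" g x)
  show ?case
  proof (cases ys)
    case (Cons y zs)
    have "dist (g x) (g y) \<le> dist (g x) (g u) + dist (g u) (g v) + dist (g v) (g y)"
      by metric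
    with Cons show ?thesis by simp
  qed auto
qed auto

lemma curve_var_eq_polysum:
  "curve_var g a b = (SUP ts \<in> {ts. sorted ts \<and> set ts \<subseteq> {a..b}}. ennreal (polysum g ts))"
  unfolding curve_var_def polysum_eq_sum ..

lemma polysum_le_curve_var:
  "sorted ts \<Longrightarrow> set ts \<subseteq> {a..b} \<Longrightarrow> ennreal (polysum g ts) \<le> curve_var g a b"
  unfolding curve_var_eq_polysum by (rule SUP_upper) auto

lemma curve_var_mono: "a' \<le> a \<Longrightarrow> b \<le> b' \<Longrightarrow> curve_var g a b \<le> curve_var g a' b'"
  unfolding curve_var_eq_polysum by (rule SUP_subset_mono) auto

lemma dist_le_curve_var: "a \<le> b \<Longrightarrow> ennreal (dist (g a) (g b)) \<le> curve_var g a b"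
  using polysum_le_curve_var[of "[a, b]" a b g] by simp

text \<open>A subdivision of \<open>{a..b}\<close> followed by one of \<open>{b..c}\<close>
  subdivides \<open>{a..c}\<close>; the inequality then passes to both suprema.\<close>

lemma curve_var_add_le: "a \<le> b \<Longrightarrow> b \<le> c \<Longrightarrow> curve_var g a b + curve_var g b c \<le> curve_var g a c"
proof -
  assume abc: "a \<le> b" "b \<le> c"
  have "ennreal (polysum g xs) + ennreal (polysum g ys) \<le> curve_var g a c"
    if "sorted xs" "set xs \<subseteq> {a..b}" "sorted ys" "set ys \<subseteq> {b..c}" for xs ys
  proof -
    have "ennreal (polysum g xs) + ennreal (polysum g ys) \<le> ennreal (polysum g (xs @ ys))"
      using polysum_append[of g xs ys] by (simp add: polysum_nonneg flip: ennreal_plus)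
    also have "\<dots> \<le> curve_var g a c"
      using that abc by (intro polysum_le_curve_var) (force simp: sorted_append)+
    finally show ?thesis .
  qed
  \<comment> \<open>Pulling the suprema out of the sum requires nonempty index sets.\<close>
  moreover have "[] \<in> {ts. sorted ts \<and> set ts \<subseteq> {x..y}}" for x y :: real
    by simp
  ultimately show ?thesis
    unfolding curve_var_eq_polysum[of g a b] curve_var_eq_polysum[of g b c]
    apply (subst ennreal_SUP_add_left[symmetric], blast)
    apply (rule SUP_least)
    apply (subst ennreal_SUP_add_right, blast)
    apply (rule SUP_least)
    apply auto
    done
qed

lemma curve_var_singleton: "curve_var g a a = 0"
proof -
  have "polysum g ts = 0" if "set ts \<subseteq> {a..a}" for ts
    using that by (induction g ts rule: polysum.induct) auto
  then show ?thesis
    unfolding curve_var_eq_polysum by (intro antisym SUP_least) auto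
qed

context
  fixes g :: "real \<Rightarrow> 'a::euclidean_space"
  assumes g: "rectifiable_curve g"
begin

lemma curve_var_finite: "0 \<le> a \<Longrightarrow> b \<le> 1 \<Longrightarrow> curve_var g a b < \<infinity>"
  using curve_var_mono[of 0 a b 1 g] g
  by (auto simp: rectifiable_curve_def intro: le_less_trans)

lemma ennreal_arclen: "ennreal (arclen g t) = curve_var g 0 (min t 1)"
  unfolding arclen_def using curve_var_finite[of 0 "min t 1"] by simp

lemma arclen_mono: "s \<le> t \<Longrightarrow> arclen g s \<le> arclen g t"
  unfolding arclen_def using curve_var_finite[of 0 "min t 1"]
  by (intro enn2real_mono curve_var_mono) auto

lemma arclen_nonpos: "t \<le> 0 \<Longrightarrow> arclen g t = 0"
  using curve_var_mono[of 0 0 t 0 g] by (simp add: arclen_def curve_var_singleton)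

lemma arclen_ge_1: "1 \<le> t \<Longrightarrow> arclen g t = arclen g 1"
  by (simp add: arclen_def min_def)

lemma arclen_nonneg: "0 \<le> arclen g t"
  by (simp add: arclen_def)

lemma dist_le_arclen:
  assumes "0 \<le> s" "s \<le> t" "t \<le> 1"
  shows "dist (g s) (g t) \<le> arclen g t - arclen g s"
proof -
  have "ennreal (arclen g s + dist (g s) (g t)) \<le> curve_var g 0 s + curve_var g s t"
    using assms dist_le_curve_var[of s t g]
    by (simp add: ennreal_arclen arclen_nonneg add_left_mono)
  also have "\<dots> \<le> ennreal (arclen g t)"
    using assms by (simp add: ennreal_arclen curve_var_add_le)
  finally show ?thesis by (simp add: arclen_nonneg flip: ennreal_plus)
qed

text \<open>A polygon almost exhausting the total length has no vertex in a short interval to the right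
  of \<open>t0\<close>, so what it loses there bounds the increment of the arc length.\<close>
lemma arclen_right_cont: "continuous (at_right t0) (arclen g)"
proof (cases "t0 \<in> {0..<1}")
  \<comment> \<open>To the right of such a \<open>t0\<close> the arc length is locally
    constant.\<close>
  case False
  then consider "t0 < 0" | "1 \<le> t0" by force
  then show ?thesis
  proof cases
    case 1
    have "((\<lambda>_. 0) \<longlongrightarrow> 0) (at_right t0)" by simp
    then have "(arclen g \<longlongrightarrow> 0) (at_right t0)"
      by (rule Lim_transform_eventually)
        (use 1 in \<open>auto intro!: eventually_at_rightI[of t0 0] simp: arclen_nonpos\<close>)
    then show ?thesis
      using 1 by (simp add: continuous_within arclen_nonpos)
  next
    case 2
    have "((\<lambda>_. arclen g 1) \<longlongrightarrow> arclen g 1) (at_right t0)" by simp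
    then have "(arclen g \<longlongrightarrow> arclen g 1) (at_right t0)"
      by (rule Lim_transform_eventually)
        (use 2 in \<open>auto intro!: eventually_at_rightI[of t0 "t0 + 1"] simp: arclen_def min_def\<close>)
    then show ?thesis
      using 2 arclen_ge_1[OF 2] by (simp add: continuous_within)
  qed
next
  case True
  show ?thesis
    unfolding continuous_within
  proof (rule tendstoI)
    fix e :: real assume e: "0 < e"
    define V where "V = curve_var g 0 1"
    have Vfin: "V < \<infinity>" using g by (simp add: V_def rectifiable_curve_def)
    obtain ts where ts: "sorted ts" "set ts \<subseteq> {0..1}" "V < ennreal (polysum g ts) + ennreal (e/2)"
    \<comment> \<open>Truncated subtraction gives \<open>V - e/2 < V\<close> only for nonzero
      \<open>V\<close>; for \<open>V = 0\<close> the empty polygon suffices.\<close>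
    proof (cases "V = 0")
      case True
      then show ?thesis using that[of "[]"] e by simp
    next
      case False
      then have "V - ennreal (e/2) < V"
        using Vfin e by (intro ennreal_between) (auto simp: zero_less_iff_neq_zero)
      then obtain ts where ts: "sorted ts" "set ts \<subseteq> {0..1}" "V - ennreal (e/2) < ennreal (polysum g ts)"
        unfolding V_def curve_var_eq_polysum less_SUP_iff by auto
      obtain v where v: "V = ennreal v" "0 \<le> v"
        using Vfin by (cases V) auto
      then have "v - e / 2 < polysum g ts"
        using ts(3) e by (simp add: ennreal_minus) (meson ennreal_leI not_less)
      then show ?thesis
        using that[of ts] ts v e by (simp add: polysum_nonneg ennreal_less_iff flip: ennreal_plus)
    qed
    define xs where "xs = takeWhile (\<lambda>x. x \<le> t0) ts"
    define ys where "ys = dropWhile (\<lambda>x. x \<le> t0) ts"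
    have split: "ts = xs @ ys" by (simp add: xs_def ys_def)
    have xs: "\<forall>x\<in>set xs. x \<le> t0" unfolding xs_def using set_takeWhileD by fastforce
    have ys: "\<forall>y\<in>set ys. t0 < y"
    proof (cases ys)
      case (Cons y zs)
      then have "\<not> y \<le> t0" unfolding ys_def by (metis dropWhile_eq_Cons_conv)
      moreover have "sorted (y # zs)" using ts(1) split Cons by (simp add: sorted_append)
      ultimately show ?thesis using Cons by auto
    qed simp
    \<comment> \<open>\<open>d\<close> is the first vertex beyond \<open>t0\<close>, or 1 if there
      is none, so \<open>t0\<close> and any \<open>t\<close> in \<open>{t0<..<d}\<close> can be
      inserted between \<open>xs\<close> and \<open>ys\<close>.\<close>
    define d where "d = Min (insert 1 (set ys))"
    have d: "t0 < d" "d \<le> 1" "\<forall>y\<in>set ys. d \<le> y"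
      using ys True unfolding d_def by auto
    have "continuous_on {0..1} g" using g by (simp add: rectifiable_curve_def path_def)
    then have "continuous (at t0 within {0..1}) g"
      using True by (simp add: continuous_on_eq_continuous_within)
    then have "continuous (at t0 within {t0..d}) g"
      by (rule continuous_within_subset) (use True d in auto)
    then have "(g \<longlongrightarrow> g t0) (at_right t0)"
      using d by (simp add: continuous_within at_within_Icc_at_right)
    then have "\<forall>\<^sub>F t in at_right t0. dist (g t) (g t0) < e / 2"
      using e by (intro tendstoD) auto
    moreover have "\<forall>\<^sub>F t in at_right t0. t \<in> {t0<..<d}"
      using d by (intro eventually_at_right_real) auto
    ultimately show "\<forall>\<^sub>F t in at_right t0. dist (arclen g t) (arclen g t0) < e"
    proof eventually_elim
      case (elim t)
      then have t: "t0 < t" "t < d" "t < 1" "0 \<le> t" using d True by auto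
      have "ennreal (arclen g t) + curve_var g t 1 \<le> V"
        unfolding V_def using t by (simp add: ennreal_arclen curve_var_add_le)
      also have "V < ennreal (polysum g ts) + ennreal (e/2)" by (rule ts)
      also have "ennreal (polysum g ts) \<le> ennreal (polysum g (xs @ [t0]) + dist (g t0) (g t) + polysum g (t # ys))"
        unfolding split by (intro ennreal_leI polysum_append_le)
      also have "\<dots> = ennreal (polysum g (xs @ [t0])) + ennreal (dist (g t0) (g t)) + ennreal (polysum g (t # ys))"
        by (simp add: polysum_nonneg)
      also have "ennreal (polysum g (xs @ [t0])) \<le> ennreal (arclen g t0)"
        using True ts xs split
        by (simp add: ennreal_arclen) (intro polysum_le_curve_var, auto simp: sorted_append)
      also have "ennreal (polysum g (t # ys)) \<le> curve_var g t 1"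
        using ts split d t by (intro polysum_le_curve_var) (force simp: sorted_append)+
      finally have "ennreal (arclen g t) + curve_var g t 1
          < ennreal (arclen g t0) + ennreal (dist (g t0) (g t)) + curve_var g t 1 + ennreal (e/2)"
        by (auto simp: add_mono)
      \<comment> \<open>The length from \<open>t\<close> to 1 occurs on both sides and is finite,
        hence it cancels.\<close>
      moreover obtain w where "curve_var g t 1 = ennreal w" "0 \<le> w"
        using curve_var_finite[of t 1] t by (cases "curve_var g t 1") auto
      ultimately have "arclen g t < arclen g t0 + dist (g t0) (g t) + e / 2"
        using e by (simp add: arclen_nonneg ennreal_less_iff flip: ennreal_plus)
      moreover have "arclen g t0 \<le> arclen g t"
        using t by (intro arclen_mono) simp
      ultimately show ?case
        using elim by (simp add: dist_real_def dist_commute)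
    qed
  qed
qed

text \<open>Monotonicity and right continuity ensure that the Stieltjes measure has the increments
  of the arc length as its values.\<close>

lemma emeasure_arclen_Ioc: "a \<le> b \<Longrightarrow> emeasure (interval_measure (arclen g)) {a<..b} = ennreal (arclen g b - arclen g a)"
  by (intro emeasure_interval_measure_Ioc arclen_mono arclen_right_cont)

end

section \<open>Line integrals of radial densities and along radial segments\<close>

text \<open>Half-open intervals form an intersection-stable generator of the Borel sets, and the
  intervals \<open>{- i<..i}\<close> of finite measure exhaust the line.\<close>

lemma measure_eqI_Ioc:
  fixes M N :: "real measure"
  assumes "sets M = sets borel" "sets N = sets borel"
    and eq: "\<And>a b. a \<le> b \<Longrightarrow> emeasure M {a<..b} = emeasure N {a<..b}"
    and fin: "\<And>a b. emeasure M {a<..b} \<noteq> \<infinity>"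
  shows "M = N"
proof (rule measure_eqI_generator_eq)
  let ?E = "range (\<lambda>(a, b). {a<..b::real})"
  show "Int_stable ?E"
    by (auto simp: Int_stable_def)
  show "sets M = sigma_sets UNIV ?E" "sets N = sigma_sets UNIV ?E"
    using assms(1,2) by (auto simp: borel_sigma_sets_Ioc)
  show "emeasure M X = emeasure N X" if "X \<in> ?E" for X
  proof -
    obtain a b where X: "X = {a<..b}" using \<open>X \<in> ?E\<close> by auto
    show ?thesis using eq[of a b] by (cases "a \<le> b") (auto simp: X)
  qed
  show "range (\<lambda>i::nat. {- real i<..real i}) \<subseteq> ?E" by auto
  show "(\<Union>i::nat. {- real i<..real i}) = UNIV"
  proof (intro equalityI subsetI UNIV_I)
    fix x :: real
    obtain n where "\<bar>x\<bar> < real n" using reals_Archimedean2 by blast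
    then show "x \<in> (\<Union>i::nat. {- real i<..real i})" by (intro UN_I[of n]) auto
  qed
qed (use fin in auto)

text \<open>The clamp \<open>max c (min d x)\<close> is, up to the constant \<open>c\<close>, the
  distribution function of Lebesgue measure on \<open>{c<..d}\<close>; this form also covers
  disjoint intervals.\<close>

lemma emeasure_lborel_Ioc_Int:
  fixes a b c d :: real
  assumes "a \<le> b" "c \<le> d"
  shows "emeasure lborel ({c<..d} \<inter> {a<..b}) = ennreal (max c (min d b) - max c (min d a))"
proof (cases "max a c \<le> min b d")
  case True
  then have "emeasure lborel ({c<..d} \<inter> {a<..b}) = emeasure lborel {max a c<..min b d}"
    by (intro arg_cong[where f="emeasure lborel"]) auto
  also have "\<dots> = ennreal (min b d - max a c)"
    using True by simp
  also have "min b d - max a c = max c (min d b) - max c (min d a)"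
    using True assms by auto
  finally show ?thesis .
next
  case False
  then have "{c<..d} \<inter> {a<..b} = {}" by auto
  moreover have "max c (min d b) - max c (min d a) = 0" using False assms by auto
  ultimately show ?thesis by simp
qed

lemma ex_sum_measure:
  assumes "sets M = sets N"
  obtains S where "sets S = sets M" "\<And>A. A \<in> sets M \<Longrightarrow> emeasure S A = emeasure M A + emeasure N A"
proof -
  define S where "S = measure_of (space M) (sets M) (\<lambda>A. emeasure M A + emeasure N A)"
  have "sets S = sets M"
    unfolding S_def by (simp add: sets.sets_measure_of_eq)
  moreover have "emeasure S A = emeasure M A + emeasure N A" if "A \<in> sets M" for A
    unfolding S_def
  proof (rule emeasure_measure_of_sigma)
    show "sigma_algebra (space M) (sets M)" by (rule sets.sigma_algebra_axioms)
    show "positive (sets M) (\<lambda>A. emeasure M A + emeasure N A)" by (simp add: positive_def)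
    show "countably_additive (sets M) (\<lambda>A. emeasure M A + emeasure N A)"
    proof (rule countably_additiveI)
      fix F :: "nat \<Rightarrow> 'a set"
      assume F: "range F \<subseteq> sets M" "disjoint_family F"
      then have FN: "range F \<subseteq> sets N" using assms by simp
      have "(\<Sum>i. emeasure M (F i) + emeasure N (F i)) = (\<Sum>i. emeasure M (F i)) + (\<Sum>i. emeasure N (F i))"
        by (intro suminf_add[symmetric] summableI)
      then show "(\<Sum>i. emeasure M (F i) + emeasure N (F i)) = emeasure M (\<Union>i. F i) + emeasure N (\<Union>i. F i)"
        using F FN by (simp add: suminf_emeasure)
    qed
  qed (use that in auto)
  ultimately show ?thesis by (rule that)
qed

text \<open>The excess of the distribution function of \<open>M\<close> over that of Lebesgue measure is monotone,
  hence defines a measure which, added to Lebesgue measure, gives \<open>M\<close>.\<close>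
lemma nn_integral_lborel_le_of_Ioc:
  fixes M :: "real measure" and f :: "real \<Rightarrow> ennreal"
  assumes fin: "finite_measure M" and sets[measurable_cong]: "sets M = sets borel" and r: "r1 \<le> r2"
    and le: "\<And>a b. r1 \<le> a \<Longrightarrow> a < b \<Longrightarrow> b \<le> r2 \<Longrightarrow> b - a \<le> measure M {a<..b}"
    and [measurable]: "f \<in> borel_measurable borel"
  shows "(\<integral>\<^sup>+x. f x * indicator {r1<..r2} x \<partial>lborel) \<le> (\<integral>\<^sup>+x. f x \<partial>M)"
proof -
  interpret finite_borel_measure M
    using fin sets by (simp add: finite_borel_measure_def finite_borel_measure_axioms_def)
  \<comment> \<open>\<open>c\<close> is, up to a constant, the distribution function of Lebesgue
    measure on \<open>{r1<..r2}\<close>, so \<open>G\<close> is the excess to be shown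
    monotone.\<close>
  define c where "c x = max r1 (min r2 x)" for x
  define G where "G x = cdf M x - c x" for x
  have mono: "G x \<le> G y" if "x \<le> y" for x y
  proof (cases "x = y")
    case False
    then have xy: "x < y" using that by simp
    have "c y - c x \<le> measure M {x<..y}"
    proof (cases "c x < c y")
      case True
      then have "c y - c x \<le> measure M {c x<..c y}"
        using r by (intro le) (auto simp: c_def)
      also have "\<dots> \<le> measure M {x<..y}"
        using True r by (intro finite_measure_mono) (auto simp: c_def max_def min_def split: if_splits)
      finally show ?thesis .
    next
      case False
      then show ?thesis using measure_nonneg[of M "{x<..y}"] by linarith
    qed
    then show ?thesis
      using cdf_diff_eq[OF xy] by (simp add: G_def)
  qed simp
  have cont: "continuous (at_right x) G" for x
    unfolding G_def c_def by (intro continuous_intros cdf_is_right_cont)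
  define L where "L = density lborel (indicator {r1<..r2} :: real \<Rightarrow> ennreal)"
  have L: "emeasure L {a<..b} = ennreal (c b - c a)" if "a \<le> b" for a b
    using emeasure_lborel_Ioc_Int[OF that r]
    unfolding L_def c_def by (subst emeasure_restricted) auto
  have I: "emeasure (interval_measure G) {a<..b} = ennreal (G b - G a)" if "a \<le> b" for a b
    by (intro emeasure_interval_measure_Ioc mono cont that)
  have setsL: "sets L = sets (interval_measure G)" by (simp add: L_def)
  obtain S where S: "sets S = sets L"
    "\<And>A. A \<in> sets L \<Longrightarrow> emeasure S A = emeasure L A + emeasure (interval_measure G) A"
    using ex_sum_measure[OF setsL] by blast
  have "S = M"
  proof (rule measure_eqI_Ioc)
    show eq: "emeasure S {a<..b} = emeasure M {a<..b}" if "a \<le> b" for a b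
    proof -
      have "emeasure S {a<..b} = ennreal (c b - c a) + ennreal (G b - G a)"
        using that S(2)[of "{a<..b}"] setsL by (simp add: L I)
      also have "\<dots> = ennreal (cdf M b - cdf M a)"
        using that mono[OF that] r by (subst ennreal_plus[symmetric]) (auto simp: G_def c_def)
      also have "\<dots> = emeasure M {a<..b}"
        using that cdf_diff_eq[of a b] by (cases "a = b") (auto simp: emeasure_eq_measure)
      finally show ?thesis .
    qed
    show "emeasure S {a<..b} \<noteq> \<infinity>" for a b
      using eq[of a b] by (cases "a \<le> b") (auto simp: emeasure_eq_measure)
  qed (use S sets in \<open>auto simp: L_def\<close>)
  then have "L \<le> M"
    using S sets by (subst le_measure) (auto simp: L_def)
  then have "(\<integral>\<^sup>+x. f x \<partial>L) \<le> (\<integral>\<^sup>+x. f x \<partial>M)"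
    using sets by (intro nn_integral_mono_measure) (auto simp: L_def)
  then show ?thesis
    by (simp add: L_def nn_integral_density mult.commute)
qed

text \<open>Take \<open>d\<close> as the first time the value \<open>b\<close> is reached and
  \<open>c\<close> as the last time before \<open>d\<close> with value \<open>a\<close>. A value
  outside \<open>{a..b}\<close> in between would, by the intermediate value theorem, give a later
  visit to \<open>a\<close> or an earlier visit to \<open>b\<close>.\<close>

lemma ivt_crossing:
  fixes h :: "real \<Rightarrow> real"
  assumes h: "continuous_on {0..1} h" and a: "h 0 \<le> a" "a < b" "b \<le> h 1"
  obtains c d where "0 \<le> c" "c < d" "d \<le> 1" "h c = a" "h d = b" "\<And>t. t \<in> {c..d} \<Longrightarrow> h t \<in> {a..b}"
proof -
  have sub: "continuous_on {x..y} h" if "0 \<le> x" "y \<le> 1" for x y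
    using h by (rule continuous_on_subset) (use that in auto)
  have comp: "compact {t \<in> {x..y}. h t = v}" if "0 \<le> x" "y \<le> 1" for x y v
    using continuous_closed_preimage_constant[OF sub[OF that], of v]
    by (auto intro: compact_Int_closed[of "{x..y}", simplified] simp: compact_eq_bounded_closed
        intro: bounded_subset[OF bounded_closed_interval])
  obtain d0 where "0 \<le> d0" "d0 \<le> 1" "h d0 = b"
    using IVT'[of h 0 b 1] a sub[of 0 1] by auto
  then have ne: "{t \<in> {0..1}. h t = b} \<noteq> {}" by auto
  obtain d where d: "d \<in> {0..1}" "h d = b" "\<And>t. t \<in> {0..1} \<Longrightarrow> h t = b \<Longrightarrow> d \<le> t"
    using compact_attains_inf[OF comp[of 0 1 b] ne] by auto
  obtain c0 where "0 \<le> c0" "c0 \<le> d" "h c0 = a"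
    using IVT'[of h 0 a d] a d sub[of 0 d] by auto
  then have ne: "{t \<in> {0..d}. h t = a} \<noteq> {}" by auto
  obtain c where c: "c \<in> {0..d}" "h c = a" "\<And>t. t \<in> {0..d} \<Longrightarrow> h t = a \<Longrightarrow> t \<le> c"
    using compact_attains_sup[OF comp[of 0 d a] ne] d(1) by auto
  have "c \<noteq> d" using c d a by auto
  moreover have "h t \<in> {a..b}" if t: "t \<in> {c..d}" for t
  proof (rule ccontr)
    assume "h t \<notin> {a..b}"
    then consider "h t < a" | "b < h t" by force
    then show False
    proof cases
      case 1
      then obtain s where "t \<le> s" "s \<le> d" "h s = a"
        using IVT'[of h t a d] a c d t sub[of t d] by auto
      then have "s \<le> c" using c t by auto
      with \<open>t \<le> s\<close> \<open>h s = a\<close> t 1 show False by (cases "s = t") auto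
    next
      case 2
      then obtain s where "0 \<le> s" "s \<le> t" "h s = b"
        using IVT'[of h 0 b t] a c d t sub[of 0 t] by auto
      then have "d \<le> s" using d t by auto
      with \<open>s \<le> t\<close> \<open>h s = b\<close> t 2 show False by (cases "s = t") auto
    qed
  qed
  ultimately show ?thesis
    using that[of c d] c d by auto
qed

text \<open>The arc length measure is pushed forward by the norm to a measure \<open>M\<close>. The
  curve crosses every shell \<open>a \<le> norm x \<le> b\<close>, and a crossing has length at
  least \<open>b - a\<close>, so \<open>M\<close> dominates Lebesgue measure on
  \<open>{r1<..r2}\<close>.\<close>

lemma nn_integral_le_line_integral_radial:
  fixes g :: "real \<Rightarrow> 'a::euclidean_space" and f :: "real \<Rightarrow> ennreal"
  assumes g: "rectifiable_curve g" and r: "r1 < r2"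
    and ends: "norm (g 0) = r1 \<and> norm (g 1) = r2 \<or> norm (g 0) = r2 \<and> norm (g 1) = r1"
    and [measurable]: "f \<in> borel_measurable borel"
  shows "(\<integral>\<^sup>+x. f x * indicator {r1<..r2} x \<partial>lborel) \<le> line_integral (\<lambda>x. f (norm x)) g"
proof -
  \<comment> \<open>Clamping the parameter extends the norm along \<open>g\<close> to a continuous,
    hence Borel, function on the whole line.\<close>
  define h where "h t = norm (g (max 0 (min 1 t)))" for t
  have cg: "continuous_on {0..1} g" using g by (simp add: rectifiable_curve_def path_def)
  have ch: "continuous_on UNIV h"
    unfolding h_def
    by (intro continuous_on_norm continuous_on_compose2[OF cg] continuous_intros) auto
  have [measurable]: "h \<in> borel_measurable borel"
    using ch by (rule borel_measurable_continuous_onI)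
  define I where "I = density (interval_measure (arclen g)) (indicator {0..1} :: real \<Rightarrow> ennreal)"
  have setsI[measurable_cong]: "sets I = sets borel" by (simp add: I_def)
  have emI: "emeasure I A = emeasure (interval_measure (arclen g)) (A \<inter> {0..1})" if "A \<in> sets borel" for A
    using that unfolding I_def by (subst emeasure_restricted) (auto simp: Int_commute)
  define M where "M = distr I borel h"
  have setsM[measurable_cong]: "sets M = sets borel" by (simp add: M_def)
  \<comment> \<open>The interval starts at -1 because it is open on the left and has to contain
    0.\<close>
  have "emeasure I UNIV \<le> emeasure (interval_measure (arclen g)) {-1<..1}"
    by (subst emI) (auto intro!: emeasure_mono)
  also have "\<dots> < \<infinity>"
    using emeasure_arclen_Ioc[OF g, of "-1" 1] by simp
  finally interpret I: finite_measure I
    using sets_eq_imp_space_eq[OF setsI] by (intro finite_measureI) simp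
  interpret M: finite_measure M
    unfolding M_def by (intro I.finite_measure_distr) measurable
  have closed: "b - a \<le> measure M {a..b}" if ab: "r1 \<le> a" "a < b" "b \<le> r2" for a b
  proof -
    have crossing: "\<exists>c d. 0 \<le> c \<and> c < d \<and> d \<le> 1 \<and> \<bar>h d - h c\<bar> = b - a \<and> (\<forall>t\<in>{c..d}. h t \<in> {a..b})"
      using ends
    proof
      assume e: "norm (g 0) = r1 \<and> norm (g 1) = r2"
      obtain c d where "0 \<le> c" "c < d" "d \<le> 1" "h c = a" "h d = b" "\<And>t. t \<in> {c..d} \<Longrightarrow> h t \<in> {a..b}"
        using ivt_crossing[of h a b] continuous_on_subset[OF ch] ab e by (auto simp: h_def)
      then show ?thesis using ab by (intro exI[of _ c] exI[of _ d]) auto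
    next
      \<comment> \<open>A curve running inwards reduces to the first case by reversing time.\<close>
      assume e: "norm (g 0) = r2 \<and> norm (g 1) = r1"
      have "continuous_on {0..1} (\<lambda>t. h (1 - t))"
        by (intro continuous_on_compose2[OF ch] continuous_intros) auto
      then obtain c d where cd: "0 \<le> c" "c < d" "d \<le> 1" "h (1 - c) = a" "h (1 - d) = b"
          "\<And>t. t \<in> {c..d} \<Longrightarrow> h (1 - t) \<in> {a..b}"
        using ivt_crossing[of "\<lambda>t. h (1 - t)" a b] ab e by (auto simp: h_def)
      have "h t \<in> {a..b}" if "t \<in> {1 - d..1 - c}" for t
        using cd(6)[of "1 - t"] that by auto
      then show ?thesis using ab cd by (intro exI[of _ "1 - d"] exI[of _ "1 - c"]) auto
    qed
    then obtain c d where cd: "0 \<le> c" "c < d" "d \<le> 1" "\<bar>h d - h c\<bar> = b - a"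
        "\<And>t. t \<in> {c..d} \<Longrightarrow> h t \<in> {a..b}" by auto
    have "b - a \<le> dist (g c) (g d)"
      using cd norm_triangle_ineq3[of "g d" "g c"] by (simp add: h_def dist_norm norm_minus_commute)
    also have "\<dots> \<le> arclen g d - arclen g c"
      using cd by (intro dist_le_arclen g) auto
    finally have "ennreal (b - a) \<le> emeasure (interval_measure (arclen g)) {c<..d}"
      using cd by (subst emeasure_arclen_Ioc[OF g]) (auto intro: ennreal_leI)
    also have "{c<..d} = {c<..d} \<inter> {0..1}"
      using cd by auto
    also have "emeasure (interval_measure (arclen g)) \<dots> = emeasure I {c<..d}"
      by (rule emI[symmetric]) simp
    also have "\<dots> \<le> emeasure I (h -` {a..b} \<inter> space I)"
      using cd sets_eq_imp_space_eq[OF setsI]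
      by (intro emeasure_mono measurable_sets[of h I borel]) auto
    also have "\<dots> = emeasure M {a..b}"
      unfolding M_def by (subst emeasure_distr) auto
    finally show ?thesis
      by (simp add: M.emeasure_eq_measure)
  qed
  have "b - a \<le> measure M {a<..b}" if ab: "r1 \<le> a" "a < b" "b \<le> r2" for a b
  proof (rule field_le_epsilon)
    fix e :: real assume "0 < e"
    \<comment> \<open>The bound for closed intervals passes to half-open ones by moving the left
      endpoint inwards by at most \<open>e\<close>; the midpoint keeps \<open>a'\<close> below
      \<open>b\<close>.\<close>
    define a' where "a' = min (a + e) ((a + b) / 2)"
    have a': "a < a'" "a' < b" "a' \<le> a + e" using ab \<open>0 < e\<close> by (auto simp: a'_def min_less_iff_disj)
    have "b - a' \<le> measure M {a'..b}" using ab a' by (intro closed) auto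
    also have "\<dots> \<le> measure M {a<..b}"
      using a' setsM by (intro M.finite_measure_mono) auto
    finally show "b - a \<le> measure M {a<..b} + e" using a' by simp
  qed
  then have "(\<integral>\<^sup>+x. f x * indicator {r1<..r2} x \<partial>lborel) \<le> (\<integral>\<^sup>+x. f x \<partial>M)"
    using r M.finite_measure_axioms setsM by (intro nn_integral_lborel_le_of_Ioc) auto
  also have "\<dots> = (\<integral>\<^sup>+t. indicator {0..1} t * f (h t) \<partial>interval_measure (arclen g))"
    unfolding M_def I_def by (simp add: nn_integral_distr nn_integral_density)
  also have "\<dots> = line_integral (\<lambda>x. f (norm x)) g"
    unfolding line_integral_def
    by (intro nn_integral_cong) (auto simp: h_def split: split_indicator)
  finally show ?thesis .
qed

section \<open>Length and line integrals along radial segments\<close>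

lemma polysum_affine_le:
  assumes g: "\<And>x y. x \<le> y \<Longrightarrow> dist (g x) (g y) = L * (y - x)" and L: "0 \<le> L"
    and "sorted ts" "set ts \<subseteq> {a..b}" "a \<le> b"
  shows "polysum g ts \<le> L * (b - a)"
  using assms(3-5)
proof (induction ts arbitrary: a)
  case Nil
  then show ?case using L by simp
next
  case (Cons x ts)
  show ?case
  proof (cases ts)
    case Nil
    then show ?thesis using L Cons.prems by simp
  next
    case (Cons y zs)
    then have "polysum g ts \<le> L * (b - y)"
      using Cons.prems by (intro Cons.IH) auto
    moreover have "dist (g x) (g y) = L * (y - x)"
      using Cons.prems Cons by (intro g) auto
    ultimately have "polysum g (x # ts) \<le> L * (b - x)"
      using Cons by (simp add: algebra_simps)
    also have "\<dots> \<le> L * (b - a)"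
      using L Cons.prems by (intro mult_left_mono) auto
    finally show ?thesis .
  qed
qed

lemma curve_var_affine:
  assumes g: "\<And>x y. x \<le> y \<Longrightarrow> dist (g x) (g y) = L * (y - x)" and L: "0 \<le> L" and "a \<le> b"
  shows "curve_var g a b = ennreal (L * (b - a))"
proof (rule antisym)
  show "curve_var g a b \<le> ennreal (L * (b - a))"
    unfolding curve_var_eq_polysum
    using assms by (intro SUP_least ennreal_leI polysum_affine_le) auto
  show "ennreal (L * (b - a)) \<le> curve_var g a b"
    using dist_le_curve_var[of a b g] assms by simp
qed

context
  fixes r1 r2 :: real and u :: "'a::euclidean_space" and g :: "real \<Rightarrow> 'a"
  assumes r: "0 < r1" "r1 < r2" and u: "norm u = 1"
  defines "g \<equiv> \<lambda>t. (r1 + (r2 - r1) * t) *\<^sub>R u"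
begin

lemma curve_var_radial_segment: "a \<le> b \<Longrightarrow> curve_var g a b = ennreal ((r2 - r1) * (b - a))"
proof (rule curve_var_affine)
  fix x y :: real assume "x \<le> y"
  have "g x - g y = ((r2 - r1) * (x - y)) *\<^sub>R u"
    by (simp add: g_def algebra_simps)
  then show "dist (g x) (g y) = (r2 - r1) * (y - x)"
    using u r \<open>x \<le> y\<close> by (simp add: dist_norm abs_mult)
qed (use r in auto)

lemma rectifiable_radial_segment: "rectifiable_curve g"
proof -
  have "path g" unfolding path_def g_def by (intro continuous_intros)
  then show ?thesis
    unfolding rectifiable_curve_def using curve_var_radial_segment[of 0 1] by simp
qed

lemma radial_segment_joining: "g \<in> joining_family r1 r2"
proof -
  have "r1 < \<bar>r1 + (r2 - r1) * t\<bar> \<and> \<bar>r1 + (r2 - r1) * t\<bar> < r2" if "0 < t" "t < 1" for t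
  proof -
    have "0 < (r2 - r1) * t" "(r2 - r1) * t < r2 - r1"
      using that r mult_strict_left_mono[of t 1 "r2 - r1"] by auto
    then show ?thesis using r by linarith
  qed
  then show ?thesis
    using rectifiable_radial_segment r u
    by (auto simp: joining_family_def rectifiable_curve_def g_def annulus_def)
qed

lemma arclen_radial_segment: "arclen g t = (r2 - r1) * max 0 (min 1 t)"
proof (cases "0 \<le> t")
  case True
  then show ?thesis
    using curve_var_radial_segment[of 0 "min t 1"] r by (simp add: arclen_def min.commute)
next
  case False
  then show ?thesis
    using arclen_nonpos[OF rectifiable_radial_segment, of t] by simp
qed

text \<open>The segment has constant speed \<open>r2 - r1\<close>, so its arc length measure is that
  multiple of Lebesgue measure on \<open>{0<..1}\<close>; the substitution
  \<open>r = r1 + (r2 - r1) * t\<close> then gives the integral over radii.\<close>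

lemma line_integral_radial_segment:
  assumes [measurable]: "\<rho> \<in> borel_measurable borel"
  shows "line_integral \<rho> g = (\<integral>\<^sup>+r. \<rho> (r *\<^sub>R u) * indicator {r1<..<r2} r \<partial>lborel)"
proof -
  define L where "L = r2 - r1"
  have L: "0 < L" using r by (simp add: L_def)
  have g: "g = (\<lambda>t. (r1 + L * t) *\<^sub>R u)" by (simp add: g_def L_def)
  have D: "emeasure (density lborel (\<lambda>t. ennreal L * indicator {0<..1} t)) {a<..b}
      = ennreal (arclen g b - arclen g a)" if "a \<le> b" for a b
  proof -
    have "emeasure (density lborel (\<lambda>t. ennreal L * indicator {0<..1} t)) {a<..b}
       = (\<integral>\<^sup>+t. ennreal L * indicator ({0<..1} \<inter> {a<..b}) t \<partial>lborel)"
      by (simp add: emeasure_density indicator_inter_arith mult.assoc del: Int_greaterThanAtMost)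
    also have "\<dots> = ennreal L * ennreal (max 0 (min 1 b) - max 0 (min 1 a))"
      using emeasure_lborel_Ioc_Int[OF that, of 0 1] by (subst nn_integral_cmult_indicator) auto
    finally show ?thesis
      using L that by (simp add: arclen_radial_segment L_def[symmetric] right_diff_distrib flip: ennreal_mult)
  qed
  have "interval_measure (arclen g) = density lborel (\<lambda>t. ennreal L * indicator {0<..1} t)"
  proof (rule measure_eqI_Ioc)
    show "emeasure (interval_measure (arclen g)) {a<..b} \<noteq> \<infinity>" for a b
      using emeasure_arclen_Ioc[OF rectifiable_radial_segment, of a b] by (cases "a \<le> b") auto
  qed (auto simp: D emeasure_arclen_Ioc[OF rectifiable_radial_segment])
  then have "line_integral \<rho> g = (\<integral>\<^sup>+t. ennreal L * indicator {0<..1} t * (\<rho> (g t) * indicator {0..1} t) \<partial>lborel)"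
    unfolding line_integral_def by (simp add: nn_integral_density g)
  also have "\<dots> = (\<integral>\<^sup>+t. ennreal L * (\<rho> ((r1 + L * t) *\<^sub>R u) * indicator {r1<..r2} (r1 + L * t)) \<partial>lborel)"
  proof (rule nn_integral_cong)
    fix t :: real
    have "r1 + L * t \<le> r2 \<longleftrightarrow> L * t \<le> L * 1"
      by (auto simp: L_def)
    also have "\<dots> \<longleftrightarrow> t \<le> 1"
      using L by simp
    finally have "r1 + L * t \<le> r2 \<longleftrightarrow> t \<le> 1" .
    then show "ennreal L * indicator {0<..1} t * (\<rho> (g t) * indicator {0..1} t)
      = ennreal L * (\<rho> ((r1 + L * t) *\<^sub>R u) * indicator {r1<..r2} (r1 + L * t))"
      using L by (simp add: g zero_less_mult_iff split: split_indicator)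
  qed
  also have "\<dots> = ennreal L * (\<integral>\<^sup>+t. \<rho> ((r1 + L * t) *\<^sub>R u) * indicator {r1<..r2} (r1 + L * t) \<partial>lborel)"
    by (rule nn_integral_cmult) measurable
  also have "\<dots> = (\<integral>\<^sup>+r. \<rho> (r *\<^sub>R u) * indicator {r1<..r2} r \<partial>lborel)"
    using L by (subst nn_integral_real_affine[of "\<lambda>r. \<rho> (r *\<^sub>R u) * indicator {r1<..r2} r" L r1]) auto
  also have "\<dots> = (\<integral>\<^sup>+r. \<rho> (r *\<^sub>R u) * indicator {r1<..<r2} r \<partial>lborel)"
    by (rule nn_integral_cong_AE, rule AE_mp[OF AE_lborel_singleton[of r2]], rule AE_I2)
       (auto split: split_indicator)
  finally show ?thesis .
qed

end

lemma admissible_radial: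
  fixes f :: "real \<Rightarrow> ennreal"
  assumes f [measurable]: "f \<in> borel_measurable borel" and r: "r1 < r2"
    and 1: "1 \<le> (\<integral>\<^sup>+x. f x * indicator {r1<..r2} x \<partial>lborel)"
  shows "admissible (\<lambda>x::'a::euclidean_space. f (norm x)) (joining_family r1 r2)"
  unfolding admissible_def
proof (intro conjI ballI impI)
  fix g :: "real \<Rightarrow> 'a" assume "g \<in> joining_family r1 r2" "rectifiable_curve g"
  then show "1 \<le> line_integral (\<lambda>x. f (norm x)) g"
    using r by (intro order.trans[OF 1] nn_integral_le_line_integral_radial) (auto simp: joining_family_def)
qed measurable

text \<open>The lower bound 1 on every ray is integrated over the directions of the points of the
  unit ball; the weight \<open>1 / norm x ^ (DIM('a) - 1)\<close> cancels the Jacobian of polar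
  coordinates.\<close>

lemma admissible_imp_weighted_integral:
  fixes \<rho> :: "'a::euclidean_space \<Rightarrow> ennreal"
  assumes adm: "admissible \<rho> (joining_family r1 r2)" and r: "0 < r1" "r1 < r2"
  shows "ennreal (omega DIM('a)) \<le>
    (\<integral>\<^sup>+x. \<rho> x * ennreal (1 / norm x ^ (DIM('a) - 1)) * indicator (annulus r1 r2) x \<partial>lborel)"
proof -
  have [measurable]: "\<rho> \<in> borel_measurable borel" using adm by (simp add: admissible_def)
  have ray: "1 \<le> (\<integral>\<^sup>+r. \<rho> (r *\<^sub>R u) * indicator {r1<..<r2} r \<partial>lborel)" if "norm u = 1" for u
    using adm radial_segment_joining[OF r that] rectifiable_radial_segment[OF r that]
    by (auto simp: admissible_def simp flip: line_integral_radial_segment[OF r that])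
  have "emeasure lborel (ball (0::'a) 1) = (\<integral>\<^sup>+y. indicator (ball (0::'a) 1) y \<partial>lborel)"
    by simp
  also have "\<dots> \<le> (\<integral>\<^sup>+y. (\<integral>\<^sup>+r. \<rho> (r *\<^sub>R (y /\<^sub>R norm y)) * indicator {r1<..<r2} r \<partial>lborel)
           * indicator (ball 0 1) (y::'a) \<partial>lborel)"
  proof (rule nn_integral_mono_AE, rule AE_mp[OF AE_lborel_singleton[of 0]], rule AE_I2, rule impI)
    fix y :: 'a assume "y \<noteq> 0"
    then show "indicator (ball 0 1) y \<le> (\<integral>\<^sup>+r. \<rho> (r *\<^sub>R (y /\<^sub>R norm y)) * indicator {r1<..<r2} r \<partial>lborel)
           * indicator (ball 0 1) y"
      using ray[of "y /\<^sub>R norm y"] by (auto split: split_indicator)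
  qed
  finally have *: "emeasure lborel (ball (0::'a) 1) \<le> \<dots>" .
  show ?thesis
    unfolding omega_eq_ball nn_integral_annulus_polar[OF \<open>\<rho> \<in> borel_measurable borel\<close> r(1)]
    by (intro mult_left_mono * zero_le)
qed

section \<open>Exchange inequalities and the multiplier\<close>

text \<open>A strict Bernoulli inequality: by the mean value theorem \<open>t powr p - p * t\<close>
  has a strict minimum at 1 on the positive axis, and at 0 the left side is
  \<open>1 - p < 0\<close>.\<close>

lemma powr_gt_tangent:
  fixes t p :: real
  assumes "0 \<le> t" "t \<noteq> 1" "1 < p"
  shows "1 + p * (t - 1) < t powr p"
proof (cases "t = 0")
  case False
  define f where "f t = t powr p - p * t" for t :: real
  have deriv: "(f has_real_derivative p * (x powr (p - 1) - 1)) (at x)" if "0 < x" for x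
    unfolding f_def using that by (auto intro!: derivative_eq_intros simp: algebra_simps)
  have "f 1 < f t"
  proof (cases "1 < t")
    case True
    then obtain z where z: "1 < z" "f t - f 1 = (t - 1) * (p * (z powr (p - 1) - 1))"
      using MVT2[of 1 t f "\<lambda>x. p * (x powr (p - 1) - 1)"] deriv by auto
    have "1 < z powr (p - 1)" using z assms by (intro gr_one_powr) auto
    then have "0 < f t - f 1" unfolding z using True assms by auto
    then show ?thesis by simp
  next
    case tl: False
    with False assms have t: "0 < t" "t < 1" by auto
    then obtain z where z: "t < z" "z < 1" "f 1 - f t = (1 - t) * (p * (z powr (p - 1) - 1))"
      using MVT2[of t 1 f "\<lambda>x. p * (x powr (p - 1) - 1)"] deriv by auto
    have "z powr (p - 1) < 1" using z t assms powr_less_mono2[of "p - 1" z 1] by auto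
    then have "f 1 - f t < 0" unfolding z using t assms by (intro mult_pos_neg) (auto simp: mult_less_0_iff)
    then show ?thesis by simp
  qed
  then show ?thesis by (simp add: f_def algebra_simps)
qed (use assms in auto)

text \<open>The Bernoulli inequality at \<open>x / y\<close>, multiplied by \<open>y powr p\<close>.
  The terms are arranged without subtraction so that the inequality carries over to
  \<open>ennreal\<close>.\<close>

lemma powr_tangent:
  fixes x y p :: real
  assumes "0 \<le> x" "0 < y" "1 < p"
  shows "y powr p + p * y powr (p - 1) * x \<le> x powr p + p * y powr (p - 1) * y" (is ?le)
    and "y powr p + p * y powr (p - 1) * x = x powr p + p * y powr (p - 1) * y \<Longrightarrow> x = y"
proof -
  have "y powr p + p * y powr (p - 1) * x < x powr p + p * y powr (p - 1) * y" if "x \<noteq> y"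
  proof -
    have "1 + p * (x / y - 1) < (x / y) powr p"
      using assms that by (intro powr_gt_tangent) auto
    then have "y powr p * (1 + p * (x / y - 1)) < y powr p * (x / y) powr p"
      using assms by simp
    moreover have "y powr p * (x / y) powr p = x powr p"
      using assms by (simp add: powr_divide)
    moreover have "y powr p = y powr (p - 1) * y"
      using assms powr_add[of y "p - 1" 1] by simp
    then have "y powr p * (1 + p * (x / y - 1)) = y powr p + p * y powr (p - 1) * x - p * y powr (p - 1) * y"
      using assms by (simp add: field_simps)
    ultimately show ?thesis by linarith
  qed
  then show ?le "y powr p + p * y powr (p - 1) * x = x powr p + p * y powr (p - 1) * y \<Longrightarrow> x = y"
    by (cases "x = y"; force)+
qed

text \<open>After integration the finite integral of \<open>a\<close> cancels. In the applications
  \<open>v\<close> and \<open>u\<close> are the energy densities of the extremal and of a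
  competitor, \<open>a\<close> and \<open>b\<close> their linear terms.\<close>

lemma nn_integral_exchange_le:
  fixes u v a b :: "'a \<Rightarrow> ennreal"
  assumes [measurable]: "u \<in> borel_measurable M" "v \<in> borel_measurable M"
      "a \<in> borel_measurable M" "b \<in> borel_measurable M"
    and le: "AE x in M. v x + b x \<le> u x + a x"
    and ab: "(\<integral>\<^sup>+x. a x \<partial>M) \<le> (\<integral>\<^sup>+x. b x \<partial>M)" and fin: "(\<integral>\<^sup>+x. a x \<partial>M) < \<infinity>"
  shows "(\<integral>\<^sup>+x. v x \<partial>M) \<le> (\<integral>\<^sup>+x. u x \<partial>M)"
proof -
  have "(\<integral>\<^sup>+x. v x \<partial>M) + (\<integral>\<^sup>+x. a x \<partial>M) \<le> (\<integral>\<^sup>+x. v x \<partial>M) + (\<integral>\<^sup>+x. b x \<partial>M)"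
    by (intro add_left_mono ab)
  also have "\<dots> = (\<integral>\<^sup>+x. v x + b x \<partial>M)" by (simp add: nn_integral_add)
  also have "\<dots> \<le> (\<integral>\<^sup>+x. u x + a x \<partial>M)" by (intro nn_integral_mono_AE le)
  also have "\<dots> = (\<integral>\<^sup>+x. u x \<partial>M) + (\<integral>\<^sup>+x. a x \<partial>M)" by (simp add: nn_integral_add)
  finally have "(\<integral>\<^sup>+x. a x \<partial>M) + (\<integral>\<^sup>+x. v x \<partial>M) \<le> (\<integral>\<^sup>+x. a x \<partial>M) + (\<integral>\<^sup>+x. u x \<partial>M)"
    by (simp only: add.commute)
  then show ?thesis
    using fin by (auto simp: ennreal_add_left_cancel_le)
qed

text \<open>The nonnegative difference \<open>g - f\<close> has integral zero and therefore vanishes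
  almost everywhere.\<close>

lemma AE_eq_of_nn_integral_le:
  fixes f g :: "'a \<Rightarrow> ennreal"
  assumes [measurable]: "f \<in> borel_measurable M" "g \<in> borel_measurable M"
    and le: "AE x in M. f x \<le> g x" and int: "(\<integral>\<^sup>+x. g x \<partial>M) \<le> (\<integral>\<^sup>+x. f x \<partial>M)"
    and fin: "(\<integral>\<^sup>+x. f x \<partial>M) < \<infinity>"
  shows "AE x in M. f x = g x"
proof -
  have "(\<integral>\<^sup>+x. g x - f x \<partial>M) = (\<integral>\<^sup>+x. g x \<partial>M) - (\<integral>\<^sup>+x. f x \<partial>M)"
    using fin le by (intro nn_integral_diff) auto
  also have "\<dots> = 0" using int fin by (intro diff_eq_0_ennreal) (auto intro: le_less_trans)
  finally have "AE x in M. g x - f x = 0"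
    by (simp add: nn_integral_0_iff_AE)
  moreover have "AE x in M. g x \<noteq> \<infinity>"
    using int fin by (intro nn_integral_PInf_AE) auto
  ultimately show ?thesis
    using le by eventually_elim (simp add: ennreal_minus_eq_0 antisym)
qed

lemma nn_integral_exchange_eq:
  fixes u v a b :: "'a \<Rightarrow> ennreal"
  assumes [measurable]: "u \<in> borel_measurable M" "v \<in> borel_measurable M"
      "a \<in> borel_measurable M" "b \<in> borel_measurable M"
    and le: "AE x in M. v x + b x \<le> u x + a x"
    and ab: "(\<integral>\<^sup>+x. a x \<partial>M) \<le> (\<integral>\<^sup>+x. b x \<partial>M)" and fin: "(\<integral>\<^sup>+x. a x \<partial>M) < \<infinity>"
    and eq: "(\<integral>\<^sup>+x. u x \<partial>M) = (\<integral>\<^sup>+x. v x \<partial>M)" and vfin: "(\<integral>\<^sup>+x. v x \<partial>M) < \<infinity>"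
  shows "AE x in M. v x + b x = u x + a x"
proof (rule AE_eq_of_nn_integral_le)
  show "(\<integral>\<^sup>+x. u x + a x \<partial>M) \<le> (\<integral>\<^sup>+x. v x + b x \<partial>M)"
    using ab eq by (simp add: nn_integral_add add_left_mono)
  have "(\<integral>\<^sup>+x. v x + b x \<partial>M) \<le> (\<integral>\<^sup>+x. u x + a x \<partial>M)"
    by (intro nn_integral_mono_AE le)
  also have "\<dots> < \<infinity>" using eq vfin fin by (simp add: nn_integral_add)
  finally show "(\<integral>\<^sup>+x. v x + b x \<partial>M) < \<infinity>" .
qed (use le in auto)

text \<open>The mass is continuous in \<open>L\<close> by dominated convergence, at most 1 for the
  small value \<open>a\<close> and at least 1 for the large value \<open>b\<close>; the intermediate
  value theorem gives \<open>L\<close>.\<close>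

lemma ex_multiplier:
  fixes w q :: "real \<Rightarrow> real"
  assumes [measurable]: "w \<in> borel_measurable borel" "q \<in> borel_measurable borel"
    and r: "r1 < r2" and m: "0 < m" and qa: "0 < qa"
    and w: "\<And>r. r \<in> {r1<..<r2} \<Longrightarrow> m \<le> w r \<and> w r \<le> M"
    and q: "\<And>r. r \<in> {r1<..<r2} \<Longrightarrow> qa \<le> q r \<and> q r \<le> qb"
  shows "\<exists>L>0. (\<integral>\<^sup>+r. ennreal ((L / w r) powr q r) * indicator {r1<..<r2} r \<partial>lborel) = 1"
proof -
  define F where "F L r = indicator {r1<..<r2} r * (L / w r) powr q r" for L r
  define \<Phi> where "\<Phi> L = (\<integral>r. F L r \<partial>lborel)" for L
  have [measurable]: "F L \<in> borel_measurable borel" for L unfolding F_def by measurable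
  have mM: "m \<le> M" and qab: "qa \<le> qb"
    using w[of "(r1 + r2) / 2"] q[of "(r1 + r2) / 2"] r by auto
  have int_const: "integrable lborel (\<lambda>r. indicator {r1<..<r2} r * C)"
    and int_const_eq: "(\<integral>r. indicator {r1<..<r2} r * C \<partial>lborel) = (r2 - r1) * C" for C :: real
    using r by (auto simp: integrable_mult_left_iff)
  \<comment> \<open>Truncating the base from below at 1 allows the exponent to be raised to
    \<open>qb\<close>, which gives a dominating constant uniform in \<open>L\<close>.\<close>
  have bound: "norm (F L r) \<le> indicator {r1<..<r2} r * (max 1 (b / m)) powr qb" if "0 \<le> L" "L \<le> b" for L b r
  proof (cases "r \<in> {r1<..<r2}")
    case True
    have "L / w r \<le> max 1 (b / m)"
      using w[OF True] m that by (intro max.coboundedI2 frac_le) auto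
    then have "(L / w r) powr q r \<le> max 1 (b / m) powr q r"
      using w[OF True] q[OF True] m qa that by (intro powr_mono2) auto
    also have "\<dots> \<le> max 1 (b / m) powr qb"
      using q[OF True] by (intro powr_mono) auto
    finally show ?thesis using True by (simp add: F_def)
  qed (simp add: F_def)
  have int: "integrable lborel (F L)" if "0 \<le> L" for L
    by (rule Bochner_Integration.integrable_bound[OF int_const[of "(max 1 (L / m)) powr qb"]])
       (use bound[OF that order.refl] in auto)
  \<comment> \<open>The constants satisfy \<open>(r2 - r1) * k \<le> 1 \<le> (r2 - r1) * K\<close>.
    Since \<open>k \<le> 1 \<le> K\<close> and \<open>q r / qa \<ge> 1\<close>, raising to the power
    \<open>q r / qa\<close> can only decrease \<open>k\<close> and increase
    \<open>K\<close>.\<close>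
  define k where "k = min 1 (1 / (r2 - r1))"
  define K where "K = max 1 (1 / (r2 - r1))"
  define a where "a = m * k powr (1 / qa)"
  define b where "b = M * K powr (1 / qa)"
  have k: "0 < k" "k \<le> 1" and K: "1 \<le> K" using r by (auto simp: k_def K_def)
  have a0: "0 < a" using m k by (simp add: a_def)
  have "k powr (1 / qa) \<le> 1" using k qa by (intro powr_le1) auto
  moreover have "1 \<le> K powr (1 / qa)" using K qa by (intro ge_one_powr_ge_zero) auto
  ultimately have ab: "a \<le> b"
    unfolding a_def b_def using mM m k by (intro mult_mono) auto
  have "\<Phi> a \<le> (\<integral>r. indicator {r1<..<r2} r * k \<partial>lborel)"
    unfolding \<Phi>_def
  proof (intro integral_mono int int_const)
    fix r
    show "F a r \<le> indicator {r1<..<r2} r * k"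
    proof (cases "r \<in> {r1<..<r2}")
      case True
      have "a / w r \<le> k powr (1 / qa)"
        using w[OF True] m k by (auto simp: a_def divide_le_eq mult.commute intro!: mult_left_mono)
      then have "(a / w r) powr q r \<le> (k powr (1 / qa)) powr q r"
        using w[OF True] q[OF True] m qa a0 by (intro powr_mono2) auto
      also have "\<dots> = k powr (q r / qa)" by (simp add: powr_powr)
      also have "\<dots> \<le> k powr 1"
        using q[OF True] qa k by (intro powr_mono') (auto simp: le_divide_eq)
      finally show ?thesis using True k by (simp add: F_def)
    qed (simp add: F_def)
  qed (use a0 in auto)
  also have "\<dots> \<le> 1"
    using r by (simp add: int_const_eq k_def min_def field_simps)
  finally have \<Phi>a: "\<Phi> a \<le> 1" .
  have "1 \<le> (r2 - r1) * K"
    using r by (simp add: K_def max_def field_simps)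
  also have "\<dots> = (\<integral>r. indicator {r1<..<r2} r * K \<partial>lborel)" by (rule int_const_eq[symmetric])
  also have "\<dots> \<le> \<Phi> b"
    unfolding \<Phi>_def
  proof (intro integral_mono int int_const)
    fix r
    show "indicator {r1<..<r2} r * K \<le> F b r"
    proof (cases "r \<in> {r1<..<r2}")
      case True
      have "K powr 1 \<le> K powr (q r / qa)"
        using q[OF True] qa K by (intro powr_mono) (auto simp: le_divide_eq)
      also have "\<dots> = (K powr (1 / qa)) powr q r" by (simp add: powr_powr)
      also have "\<dots> \<le> (b / w r) powr q r"
        using w[OF True] q[OF True] m qa K
        by (intro powr_mono2) (auto simp: b_def le_divide_eq mult.commute intro!: mult_right_mono)
      finally show ?thesis using True K by (simp add: F_def)
    qed (simp add: F_def)
  qed (use a0 ab in auto)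
  finally have \<Phi>b: "1 \<le> \<Phi> b" .
  have "continuous_on {a..b} \<Phi>"
    unfolding continuous_on_sequentially
  proof safe
    fix x l assume l: "l \<in> {a..b}" and x: "\<forall>n. x n \<in> {a..b}" "x \<longlonglongrightarrow> l"
    show "(\<Phi> \<circ> x) \<longlonglongrightarrow> \<Phi> l"
      unfolding o_def \<Phi>_def
    proof (rule integral_dominated_convergence)
      show "AE r in lborel. (\<lambda>i. F (x i) r) \<longlonglongrightarrow> F l r"
      proof (rule AE_I2)
        fix r
        show "(\<lambda>i. F (x i) r) \<longlonglongrightarrow> F l r"
        proof (cases "r \<in> {r1<..<r2}")
          case True
          then have "l / w r \<noteq> 0" "w r \<noteq> 0" using w[OF True] m l a0 by auto
          then show ?thesis
            unfolding F_def by (intro tendsto_intros x disjI1)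
        qed (simp add: F_def)
      qed
      show "AE r in lborel. norm (F (x i) r) \<le> indicator {r1<..<r2} r * (max 1 (b / m)) powr qb" for i
        using bound[of "x i" b] x a0 by (intro AE_I2) (simp add: order.trans[of 0 a])
    qed (use int_const in auto)
  qed
  then obtain L where L: "a \<le> L" "L \<le> b" "\<Phi> L = 1"
    using IVT'[of \<Phi> a 1 b] \<Phi>a \<Phi>b ab by auto
  have "(\<integral>\<^sup>+r. ennreal ((L / w r) powr q r) * indicator {r1<..<r2} r \<partial>lborel) = (\<integral>\<^sup>+r. ennreal (F L r) \<partial>lborel)"
    by (intro nn_integral_cong) (auto simp: F_def split: split_indicator)
  also have "\<dots> = ennreal (\<Phi> L)"
    unfolding \<Phi>_def using L a0 by (intro nn_integral_eq_integral int) (auto simp: F_def)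
  finally show ?thesis using L a0 by (intro exI[of _ L]) auto
qed

section \<open>Null sets and Borel representatives\<close>

lemma nn_integral_lebesgue_on_Icc:
  fixes f :: "real \<Rightarrow> ennreal"
  shows "(\<integral>\<^sup>+r. f r \<partial>lebesgue_on {a..b}) = (\<integral>\<^sup>+r. f r * indicator {a<..<b} r \<partial>lborel)"
proof -
  have "(\<integral>\<^sup>+r. f r \<partial>lebesgue_on {a..b}) = (\<integral>\<^sup>+r. f r * indicator {a..b} r \<partial>lborel)"
    by (simp add: nn_integral_restrict_space nn_integral_completion)
  also have "\<dots> = (\<integral>\<^sup>+r. f r * indicator {a<..<b} r \<partial>lborel)"
  proof (rule nn_integral_cong_AE)
    show "AE r in lborel. f r * indicator {a..b} r = f r * indicator {a<..<b} r"
      using AE_lborel_singleton[of a] AE_lborel_singleton[of b]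
      by eventually_elim (auto split: split_indicator)
  qed
  finally show ?thesis .
qed

lemma AE_lebesgue_on_IccI:
  assumes "AE r in lborel. r \<in> {a<..<b::real} \<longrightarrow> Q r"
  shows "AE r in lebesgue_on {a..b}. r \<in> {a<..<b} \<and> Q r"
proof -
  have "AE r in lborel. r \<in> {a..b} \<longrightarrow> r \<in> {a<..<b} \<and> Q r"
    using assms AE_lborel_singleton[of a] AE_lborel_singleton[of b]
    by eventually_elim auto
  then show ?thesis
    by (subst AE_restrict_space_iff) (auto intro: AE_completion)
qed

text \<open>The indicator of a null set of radii, composed with \<open>norm\<close>, has integral
  zero over the annulus by polar coordinates.\<close>

lemma AE_annulus_radial:
  assumes ae: "AE r in lborel. r \<in> {r1<..<r2} \<longrightarrow> Q r" and r: "0 < r1"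
  shows "AE x in lborel. (x::'a::euclidean_space) \<in> annulus r1 r2 \<longrightarrow> Q (norm x)"
proof -
  obtain N where N: "{r. \<not> (r \<in> {r1<..<r2} \<longrightarrow> Q r)} \<subseteq> N" "N \<in> null_sets lborel"
    using ae by (auto simp: eventually_ae_filter)
  have [measurable]: "N \<in> sets borel" using N(2) by auto
  have [measurable]: "annulus r1 r2 \<in> sets (borel :: 'a measure)"
    unfolding annulus_def by measurable
  have "(\<integral>\<^sup>+x. indicator N (norm x) * indicator (annulus r1 r2) (x::'a) \<partial>lborel)
    = ennreal (omega DIM('a)) * (\<integral>\<^sup>+r. indicator N r * ennreal (r ^ (DIM('a) - 1)) * indicator {r1<..<r2} r \<partial>lborel)"
    using r by (intro nn_integral_annulus_radial) auto
  also have "(\<integral>\<^sup>+r. indicator N r * ennreal (r ^ (DIM('a) - 1)) * indicator {r1<..<r2} r \<partial>lborel) = 0"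
  proof -
    have "AE r in lborel. r \<notin> N" using N(2) by (rule AE_not_in)
    then have "AE r in lborel. indicator N r * ennreal (r ^ (DIM('a) - 1)) * indicator {r1<..<r2} r = 0"
      by eventually_elim simp
    then show ?thesis by (subst nn_integral_0_iff_AE) auto
  qed
  finally have "AE x in lborel. indicator N (norm x) * indicator (annulus r1 r2) (x::'a) = (0::ennreal)"
    by (simp add: nn_integral_0_iff_AE)
  then show ?thesis
  proof eventually_elim
    case (elim x)
    then show ?case using N(1) by (auto simp: annulus_def split: split_indicator_asm)
  qed
qed

text \<open>A Lebesgue measurable function agrees almost everywhere with a Borel one; clamping to
  \<open>{pm..pM}\<close> makes the bounds hold everywhere and does not affect the values of
  \<open>p\<close>.\<close>

lemma ex_borel_exponent:
  fixes p :: "real \<Rightarrow> real"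
  assumes p: "p \<in> borel_measurable (lebesgue_on {r1<..<r2})"
    and b: "\<And>r. r \<in> {r1<..<r2} \<Longrightarrow> pm \<le> p r \<and> p r \<le> pM" and "pm \<le> pM"
  obtains P where "P \<in> borel_measurable borel" "\<And>r. pm \<le> P r \<and> P r \<le> pM"
    "AE r in lborel. r \<in> {r1<..<r2} \<longrightarrow> P r = p r"
proof -
  have "(\<lambda>r. if r \<in> {r1<..<r2} then p r else 0) \<in> borel_measurable lebesgue"
    using p by (subst borel_measurable_if) auto
  then obtain P0 where P0: "P0 \<in> borel_measurable lborel"
    "AE r in lborel. (if r \<in> {r1<..<r2} then p r else 0) = P0 r"
    using completion_ex_borel_measurable_real by blast
  show ?thesis
  proof (rule that[of "\<lambda>r. max pm (min pM (P0 r))"])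
    show "(\<lambda>r. max pm (min pM (P0 r))) \<in> borel_measurable borel"
      using P0(1) by simp
    show "AE r in lborel. r \<in> {r1<..<r2} \<longrightarrow> max pm (min pM (P0 r)) = p r"
      using P0(2)
    proof eventually_elim
      case (elim r)
      then show ?case using b[of r] by auto
    qed
  qed (use assms(3) in auto)
qed

section \<open>The radial extremal density\<close>

lemma epow_ennreal: "0 \<le> t \<Longrightarrow> epow (ennreal t) a = ennreal (t powr a)"
  by (simp add: epow_def)

lemma borel_measurable_epow [measurable]:
  assumes [measurable]: "f \<in> borel_measurable M" "a \<in> borel_measurable M"
  shows "(\<lambda>x. epow (f x) (a x)) \<in> borel_measurable M"
  unfolding epow_def by measurable

text \<open>\<open>\<phi>\<close> solves the Euler--Lagrange equation \<open>P r * \<phi> r powr (P r - 1) * r ^ (n - 1) = L\<close>.\<close>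
locale radial_extremal =
  fixes r1 r2 pm pM L :: real and P \<phi> :: "real \<Rightarrow> real" and n :: nat
  assumes r1: "0 < r1" and r12: "r1 < r2" and pm: "1 < pm" and L: "0 < L"
    and P_borel [measurable]: "P \<in> borel_measurable borel"
    and P_bounds: "\<And>r. pm \<le> P r \<and> P r \<le> pM"
  defines "\<phi> \<equiv> \<lambda>r. (L / (P r * r ^ (n - 1))) powr (1 / (P r - 1))"
  assumes mass: "(\<integral>\<^sup>+r. ennreal (\<phi> r) * indicator {r1<..<r2} r \<partial>lborel) = 1"
begin

lemma phi_borel [measurable]: "\<phi> \<in> borel_measurable borel"
  unfolding \<phi>_def by measurable

lemma phi_nonneg: "0 \<le> \<phi> r"
  by (simp add: \<phi>_def)

lemma P_gt_1: "1 < P r"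
  using P_bounds[of r] pm by simp

lemma phi_pos: "0 < r \<Longrightarrow> 0 < \<phi> r"
  using L P_gt_1[of r] by (simp add: \<phi>_def)

lemma euler_lagrange:
  assumes "0 < r"
  shows "P r * \<phi> r powr (P r - 1) = L / r ^ (n - 1)"
proof -
  have "\<phi> r powr (P r - 1) = L / (P r * r ^ (n - 1))"
    using assms L P_gt_1[of r] by (simp add: \<phi>_def powr_powr)
  then show ?thesis
    using assms P_gt_1[of r] by (simp add: field_simps)
qed

text \<open>By the Euler--Lagrange equation the slope of the tangent at \<open>\<phi> r\<close> is
  \<open>L / r ^ (n - 1)\<close>, in which the exponent no longer appears.\<close>

lemma tangent:
  assumes "0 < r" "0 \<le> x"
  shows "\<phi> r powr P r + L / r ^ (n - 1) * x \<le> x powr P r + L / r ^ (n - 1) * \<phi> r"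
    and "\<phi> r powr P r + L / r ^ (n - 1) * x = x powr P r + L / r ^ (n - 1) * \<phi> r \<Longrightarrow> x = \<phi> r"
  using powr_tangent[OF assms(2) phi_pos[OF assms(1)] P_gt_1[of r]]
  unfolding euler_lagrange[OF assms(1)] by auto

text \<open>Multiplication by the radial weight turns the slope into the constant \<open>L\<close>,
  so the linear terms integrate to multiples of the masses.\<close>

lemma scaled_tangent:
  assumes "0 < r" "0 \<le> x"
  shows "\<phi> r powr P r * r ^ (n - 1) + L * x \<le> x powr P r * r ^ (n - 1) + L * \<phi> r"
    and "\<phi> r powr P r * r ^ (n - 1) + L * x = x powr P r * r ^ (n - 1) + L * \<phi> r \<Longrightarrow> x = \<phi> r"
proof -
  have s: "(y powr P r + L / r ^ (n - 1) * z) * r ^ (n - 1) = y powr P r * r ^ (n - 1) + L * z" for y z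
    using assms by (simp add: algebra_simps)
  show "\<phi> r powr P r * r ^ (n - 1) + L * x \<le> x powr P r * r ^ (n - 1) + L * \<phi> r"
    unfolding s[symmetric] using assms by (intro mult_right_mono tangent) auto
  show "\<phi> r powr P r * r ^ (n - 1) + L * x = x powr P r * r ^ (n - 1) + L * \<phi> r \<Longrightarrow> x = \<phi> r"
    unfolding s[symmetric] using assms by (intro tangent(2)) auto
qed

text \<open>Since \<open>\<phi> powr P * r ^ (n - 1) = L / P * \<phi>\<close>, the energy is at most \<open>L\<close> times the mass.\<close>
lemma energy_finite: "(\<integral>\<^sup>+r. ennreal (\<phi> r powr P r * r ^ (n - 1)) * indicator {r1<..<r2} r \<partial>lborel) < \<infinity>"
proof -
  have "(\<integral>\<^sup>+r. ennreal (\<phi> r powr P r * r ^ (n - 1)) * indicator {r1<..<r2} r \<partial>lborel)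
     \<le> (\<integral>\<^sup>+r. ennreal L * (ennreal (\<phi> r) * indicator {r1<..<r2} r) \<partial>lborel)"
  proof (rule nn_integral_mono)
    fix r
    have "\<phi> r powr P r * r ^ (n - 1) \<le> L * \<phi> r" if "r \<in> {r1<..<r2}"
    proof -
      have r: "0 < r" using that r1 by simp
      have "\<phi> r powr P r = \<phi> r powr (P r - 1) * \<phi> r"
        using phi_pos[OF r] powr_add[of "\<phi> r" "P r - 1" 1] by simp
      moreover have "\<phi> r powr (P r - 1) \<le> P r * \<phi> r powr (P r - 1)"
        using P_gt_1[of r] by (simp add: mult_le_cancel_right1)
      then have "\<phi> r powr (P r - 1) * \<phi> r \<le> L / r ^ (n - 1) * \<phi> r"
        unfolding euler_lagrange[OF r] by (rule mult_right_mono) (rule phi_nonneg)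
      ultimately have "\<phi> r powr P r \<le> L / r ^ (n - 1) * \<phi> r"
        by simp
      then show ?thesis
        using r by (simp add: field_simps)
    qed
    then show "ennreal (\<phi> r powr P r * r ^ (n - 1)) * indicator {r1<..<r2} r
        \<le> ennreal L * (ennreal (\<phi> r) * indicator {r1<..<r2} r)"
      using L phi_nonneg[of r] by (auto split: split_indicator intro!: ennreal_leI simp flip: ennreal_mult)
  qed
  also have "\<dots> = ennreal L"
    using mass by (subst nn_integral_cmult) auto
  finally show ?thesis by (simp add: le_less_trans)
qed

section \<open>The one-dimensional variational problem\<close>

context
  fixes p :: "real \<Rightarrow> real"
  assumes p: "AE r in lborel. r \<in> {r1<..<r2} \<longrightarrow> P r = p r"
begin

lemma p_AE: "AE r in lebesgue_on {r1..r2}. r \<in> {r1<..<r2} \<and> P r = p r"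
  using p by (rule AE_lebesgue_on_IccI)

lemma lebesgue_on_borel:
  "f \<in> borel_measurable borel \<Longrightarrow> f \<in> borel_measurable (lebesgue_on {r1..r2})"
  by (intro measurable_restrict_space1 measurable_completion) simp

lemma radial_energy_eq:
  "radial_energy n p r1 r2 \<psi> =
    ennreal (omega n) * (\<integral>\<^sup>+r. ennreal (\<psi> r powr P r * r ^ (n - 1)) \<partial>lebesgue_on {r1..r2})"
  unfolding radial_energy_def
proof (rule arg_cong2[where f="(*)", OF refl], rule nn_integral_cong_AE)
  show "AE r in lebesgue_on {r1..r2}. ennreal (\<psi> r powr p r * r ^ (n - 1)) = ennreal (\<psi> r powr P r * r ^ (n - 1))"
    using p_AE by eventually_elim simp
qed

lemma phi_radial_class: "\<phi> \<in> radial_class r1 r2"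
  unfolding radial_class_def
  by (auto simp: phi_nonneg nn_integral_lebesgue_on_Icc mass intro: lebesgue_on_borel)

lemma phi_mass: "(\<integral>\<^sup>+r. ennreal L * ennreal (\<phi> r) \<partial>lebesgue_on {r1..r2}) = ennreal L"
proof -
  have "(\<integral>\<^sup>+r. ennreal L * ennreal (\<phi> r) \<partial>lebesgue_on {r1..r2})
      = ennreal L * (\<integral>\<^sup>+r. ennreal (\<phi> r) \<partial>lebesgue_on {r1..r2})"
    by (intro nn_integral_cmult) (auto intro: lebesgue_on_borel)
  then show ?thesis by (simp add: nn_integral_lebesgue_on_Icc mass)
qed

context
  fixes \<psi> :: "real \<Rightarrow> real"
  assumes psi: "\<psi> \<in> radial_class r1 r2"
begin

lemma psi_measurable:
  "(\<lambda>r. ennreal (\<psi> r powr P r * r ^ (n - 1))) \<in> borel_measurable (lebesgue_on {r1..r2})"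
  "(\<lambda>r. ennreal (\<phi> r powr P r * r ^ (n - 1))) \<in> borel_measurable (lebesgue_on {r1..r2})"
  "(\<lambda>r. ennreal L * ennreal (\<phi> r)) \<in> borel_measurable (lebesgue_on {r1..r2})"
  "(\<lambda>r. ennreal L * ennreal (\<psi> r)) \<in> borel_measurable (lebesgue_on {r1..r2})"
proof -
  have [measurable]: "\<psi> \<in> borel_measurable (lebesgue_on {r1..r2})"
    using psi by (simp add: radial_class_def)
  have [measurable]: "P \<in> borel_measurable (lebesgue_on {r1..r2})"
      "\<phi> \<in> borel_measurable (lebesgue_on {r1..r2})" "(\<lambda>r. r) \<in> borel_measurable (lebesgue_on {r1..r2})"
    by (auto intro: lebesgue_on_borel)
  show "(\<lambda>r. ennreal (\<psi> r powr P r * r ^ (n - 1))) \<in> borel_measurable (lebesgue_on {r1..r2})"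
    "(\<lambda>r. ennreal (\<phi> r powr P r * r ^ (n - 1))) \<in> borel_measurable (lebesgue_on {r1..r2})"
    "(\<lambda>r. ennreal L * ennreal (\<phi> r)) \<in> borel_measurable (lebesgue_on {r1..r2})"
    "(\<lambda>r. ennreal L * ennreal (\<psi> r)) \<in> borel_measurable (lebesgue_on {r1..r2})"
    by measurable
qed

lemma psi_nonneg: "r \<in> {r1<..<r2} \<Longrightarrow> 0 \<le> \<psi> r"
  using psi by (auto simp: radial_class_def)

lemma tangent_AE:
  "AE r in lebesgue_on {r1..r2}. ennreal (\<phi> r powr P r * r ^ (n - 1)) + ennreal L * ennreal (\<psi> r)
     \<le> ennreal (\<psi> r powr P r * r ^ (n - 1)) + ennreal L * ennreal (\<phi> r)"
  using p_AE
proof eventually_elim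
  case (elim r)
  then have "0 < r" "0 \<le> \<psi> r" using r1 psi_nonneg by auto
  then show ?case
    using scaled_tangent(1)[of r "\<psi> r"] L phi_nonneg[of r]
    by (simp flip: ennreal_mult ennreal_plus)
qed

lemma psi_mass:
  "(\<integral>\<^sup>+r. ennreal L * ennreal (\<phi> r) \<partial>lebesgue_on {r1..r2}) \<le> (\<integral>\<^sup>+r. ennreal L * ennreal (\<psi> r) \<partial>lebesgue_on {r1..r2})"
proof -
  have "ennreal L * 1 \<le> ennreal L * (\<integral>\<^sup>+r. ennreal (\<psi> r) \<partial>lebesgue_on {r1..r2})"
    using psi by (intro mult_left_mono) (auto simp: radial_class_def)
  also have "\<dots> = (\<integral>\<^sup>+r. ennreal L * ennreal (\<psi> r) \<partial>lebesgue_on {r1..r2})"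
    using psi by (intro nn_integral_cmult[symmetric]) (auto simp: radial_class_def)
  finally show ?thesis by (simp add: phi_mass)
qed

lemma radial_energy_phi_le: "radial_energy n p r1 r2 \<phi> \<le> radial_energy n p r1 r2 \<psi>"
  unfolding radial_energy_eq
  by (intro mult_left_mono nn_integral_exchange_le[OF psi_measurable tangent_AE psi_mass] zero_le)
    (simp add: phi_mass)

text \<open>Equal finite energies force equality in the tangent inequality almost everywhere, and
  strict convexity then gives \<open>\<psi> r = \<phi> r\<close>.\<close>

lemma radial_minimizer_unique:
  assumes n: "0 < n" and eq: "radial_energy n p r1 r2 \<psi> = radial_energy n p r1 r2 \<phi>"
  shows "AE r in lebesgue_on {r1..r2}. \<psi> r = \<phi> r"
proof -
  have fin: "(\<integral>\<^sup>+r. ennreal L * ennreal (\<phi> r) \<partial>lebesgue_on {r1..r2}) < \<infinity>"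
    by (simp add: phi_mass)
  have vfin: "(\<integral>\<^sup>+r. ennreal (\<phi> r powr P r * r ^ (n - 1)) \<partial>lebesgue_on {r1..r2}) < \<infinity>"
    using energy_finite by (simp only: nn_integral_lebesgue_on_Icc)
  \<comment> \<open>The factor \<open>omega n\<close> is positive and finite, hence it
    cancels.\<close>
  have "(\<integral>\<^sup>+r. ennreal (\<psi> r powr P r * r ^ (n - 1)) \<partial>lebesgue_on {r1..r2})
      = (\<integral>\<^sup>+r. ennreal (\<phi> r powr P r * r ^ (n - 1)) \<partial>lebesgue_on {r1..r2})"
    using eq omega_pos[OF n] unfolding radial_energy_eq by (simp add: ennreal_mult_cancel_left)
  then have "AE r in lebesgue_on {r1..r2}. ennreal (\<phi> r powr P r * r ^ (n - 1)) + ennreal L * ennreal (\<psi> r)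
     = ennreal (\<psi> r powr P r * r ^ (n - 1)) + ennreal L * ennreal (\<phi> r)"
    by (rule nn_integral_exchange_eq[OF psi_measurable tangent_AE psi_mass fin _ vfin])
  with p_AE show ?thesis
  proof eventually_elim
    case (elim r)
    then have r: "0 < r" "0 \<le> \<psi> r" using r1 psi_nonneg by auto
    then have "\<phi> r powr P r * r ^ (n - 1) + L * \<psi> r = \<psi> r powr P r * r ^ (n - 1) + L * \<phi> r"
      using elim L phi_nonneg[of r] by (simp flip: ennreal_mult ennreal_plus)
    then show ?case by (rule scaled_tangent(2)[OF r])
  qed
qed

end

section \<open>Comparison of the modulus with the radial energy\<close>

lemma radial_energy_phi:
  "radial_energy n p r1 r2 \<phi> =
    ennreal (omega n) * (\<integral>\<^sup>+r. ennreal (\<phi> r powr P r) * ennreal (r ^ (n - 1)) * indicator {r1<..<r2} r \<partial>lborel)"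
  unfolding radial_energy_eq nn_integral_lebesgue_on_Icc
proof (rule arg_cong2[where f="(*)", OF refl], rule nn_integral_cong)
  fix r
  show "ennreal (\<phi> r powr P r * r ^ (n - 1)) * indicator {r1<..<r2} r =
    ennreal (\<phi> r powr P r) * ennreal (r ^ (n - 1)) * indicator {r1<..<r2} r"
    using r1 by (cases "r \<in> {r1<..<r2}") (auto simp: ennreal_mult)
qed

lemma nn_integral_phi_annulus:
  assumes n: "n = DIM('a::euclidean_space)"
  shows "(\<integral>\<^sup>+x. ennreal (\<phi> (norm x) powr P (norm x)) * indicator (annulus r1 r2) (x::'a) \<partial>lborel)
    = radial_energy n p r1 r2 \<phi>"
proof -
  have "(\<lambda>r. ennreal (\<phi> r powr P r)) \<in> borel_measurable borel" by measurable
  from nn_integral_annulus_radial[OF this r1, of r2, where 'a='a]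
  show ?thesis unfolding radial_energy_phi by (simp only: n)
qed

lemma annulus_integral_exponent:
  fixes \<rho> :: "'a::euclidean_space \<Rightarrow> ennreal"
  shows "(\<integral>\<^sup>+x. epow (\<rho> x) (p (norm x)) * indicator (annulus r1 r2) x \<partial>lebesgue)
    = (\<integral>\<^sup>+x. epow (\<rho> x) (P (norm x)) * indicator (annulus r1 r2) x \<partial>lborel)"
  unfolding nn_integral_completion
proof (rule nn_integral_cong_AE)
  show "AE x in lborel. epow (\<rho> x) (p (norm x)) * indicator (annulus r1 r2) x =
    epow (\<rho> x) (P (norm x)) * indicator (annulus r1 r2) x"
    using AE_annulus_radial[OF p r1] by eventually_elim (auto split: split_indicator)
qed

lemma var_modulus_le:
  assumes n: "n = DIM('a::euclidean_space)"
  shows "var_modulus (\<lambda>x::'a. p (norm x)) (annulus r1 r2) (joining_family r1 r2) \<le> radial_energy n p r1 r2 \<phi>"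
proof -
  have "(\<integral>\<^sup>+r. ennreal (\<phi> r) * indicator {r1<..<r2} r \<partial>lborel) \<le> (\<integral>\<^sup>+r. ennreal (\<phi> r) * indicator {r1<..r2} r \<partial>lborel)"
    by (intro nn_integral_mono) (auto split: split_indicator)
  then have adm: "admissible (\<lambda>x::'a. ennreal (\<phi> (norm x))) (joining_family r1 r2)"
    using mass r12 by (intro admissible_radial) auto
  have "var_modulus (\<lambda>x::'a. p (norm x)) (annulus r1 r2) (joining_family r1 r2)
    \<le> (\<integral>\<^sup>+x. epow (ennreal (\<phi> (norm x))) (P (norm x)) * indicator (annulus r1 r2) (x::'a) \<partial>lborel)"
    unfolding var_modulus_def annulus_integral_exponent by (rule INF_lower) (use adm in simp)
  also have "\<dots> = (\<integral>\<^sup>+x. ennreal (\<phi> (norm x) powr P (norm x)) * indicator (annulus r1 r2) (x::'a) \<partial>lborel)"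
    by (simp add: epow_ennreal phi_nonneg)
  also have "\<dots> = radial_energy n p r1 r2 \<phi>"
    by (rule nn_integral_phi_annulus[OF n])
  finally show ?thesis .
qed

text \<open>At \<open>y = \<infinity>\<close> the power \<open>epow y (P r)\<close> is infinite, so
  only finite \<open>y\<close> calls for the real tangent inequality.\<close>

lemma tangent_ennreal:
  assumes r: "0 < r"
  shows "ennreal (\<phi> r powr P r) + ennreal (L / r ^ (n - 1)) * y \<le> epow y (P r) + ennreal (L / r ^ (n - 1)) * ennreal (\<phi> r)"
proof (cases y)
  case (real t)
  then show ?thesis
    using tangent(1)[OF r, of t] L r phi_nonneg[of r]
    by (simp add: epow_ennreal flip: ennreal_mult ennreal_plus)
qed (simp add: epow_def)

lemma var_modulus_ge:
  assumes n: "n = DIM('a::euclidean_space)"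
  shows "radial_energy n p r1 r2 \<phi> \<le> var_modulus (\<lambda>x::'a. p (norm x)) (annulus r1 r2) (joining_family r1 r2)"
  unfolding var_modulus_def annulus_integral_exponent
proof (rule INF_greatest)
  fix \<rho> :: "'a \<Rightarrow> ennreal"
  assume "\<rho> \<in> {\<rho>. admissible \<rho> (joining_family r1 r2)}"
  then have adm: "admissible \<rho> (joining_family r1 r2)" by simp
  then have [measurable]: "\<rho> \<in> borel_measurable borel" by (simp add: admissible_def)
  have [measurable]: "annulus r1 r2 \<in> sets (borel :: 'a measure)"
    unfolding annulus_def by measurable
  let ?A = "annulus r1 r2 :: 'a set"
  define w where "w x = ennreal L * ennreal (1 / norm x ^ (n - 1))" for x :: 'a
  have [measurable]: "w \<in> borel_measurable borel" unfolding w_def by measurable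
  have w: "w x = ennreal (L / norm x ^ (n - 1))" for x
    using L by (simp add: w_def flip: ennreal_mult)
  have "radial_energy n p r1 r2 \<phi> = (\<integral>\<^sup>+x. ennreal (\<phi> (norm x) powr P (norm x)) * indicator ?A x \<partial>lborel)"
    by (rule nn_integral_phi_annulus[OF n, symmetric])
  also have "\<dots> \<le> (\<integral>\<^sup>+x. epow (\<rho> x) (P (norm x)) * indicator ?A x \<partial>lborel)"
  \<comment> \<open>The linear terms are \<open>w * \<phi>\<close> and \<open>w * \<rho>\<close> on
    the annulus: the first integrates to \<open>omega n * L\<close> because \<open>\<phi>\<close>
    has mass 1, the second to at least that because \<open>\<rho>\<close> is admissible.\<close>
  proof (rule nn_integral_exchange_le)
    show "AE x in lborel. ennreal (\<phi> (norm x) powr P (norm x)) * indicator ?A x + w x * \<rho> x * indicator ?A x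
        \<le> epow (\<rho> x) (P (norm x)) * indicator ?A x + w x * ennreal (\<phi> (norm x)) * indicator ?A x"
    proof (rule AE_I2)
      fix x :: 'a
      show "ennreal (\<phi> (norm x) powr P (norm x)) * indicator ?A x + w x * \<rho> x * indicator ?A x
        \<le> epow (\<rho> x) (P (norm x)) * indicator ?A x + w x * ennreal (\<phi> (norm x)) * indicator ?A x"
      proof (cases "x \<in> ?A")
        case True
        then have "0 < norm x" using r1 by (auto simp: annulus_def)
        from tangent_ennreal[OF this, of "\<rho> x"] True show ?thesis by (simp add: w)
      qed simp
    qed
    have "(\<integral>\<^sup>+x. w x * ennreal (\<phi> (norm x)) * indicator ?A x \<partial>lborel) =
        ennreal (omega n) * (\<integral>\<^sup>+r. (ennreal L * ennreal (1 / r ^ (n - 1)) * ennreal (\<phi> r)) * ennreal (r ^ (n - 1))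
          * indicator {r1<..<r2} r \<partial>lborel)"
      unfolding w_def n using r1 by (intro nn_integral_annulus_radial) auto
    also have "(\<integral>\<^sup>+r. (ennreal L * ennreal (1 / r ^ (n - 1)) * ennreal (\<phi> r)) * ennreal (r ^ (n - 1))
          * indicator {r1<..<r2} r \<partial>lborel) = (\<integral>\<^sup>+r. ennreal L * (ennreal (\<phi> r) * indicator {r1<..<r2} r) \<partial>lborel)"
      using r1 L phi_nonneg
      by (intro nn_integral_cong) (auto simp flip: ennreal_mult split: split_indicator)
    also have "\<dots> = ennreal L"
      using mass by (subst nn_integral_cmult) auto
    finally have a: "(\<integral>\<^sup>+x. w x * ennreal (\<phi> (norm x)) * indicator ?A x \<partial>lborel) = ennreal (omega n) * ennreal L" .
    then show "(\<integral>\<^sup>+x. w x * ennreal (\<phi> (norm x)) * indicator ?A x \<partial>lborel) < \<infinity>"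
      by (simp add: ennreal_mult_less_top)
    have "ennreal (omega n) * ennreal L = ennreal L * ennreal (omega DIM('a))"
      by (simp add: n mult.commute)
    also have "\<dots> \<le> ennreal L * (\<integral>\<^sup>+x. \<rho> x * ennreal (1 / norm x ^ (DIM('a) - 1)) * indicator ?A x \<partial>lborel)"
      by (intro mult_left_mono admissible_imp_weighted_integral adm r1 r12 zero_le)
    also have "\<dots> = (\<integral>\<^sup>+x. w x * \<rho> x * indicator ?A x \<partial>lborel)"
      unfolding w_def n by (subst nn_integral_cmult[symmetric]) (auto simp: mult_ac)
    finally show "(\<integral>\<^sup>+x. w x * ennreal (\<phi> (norm x)) * indicator ?A x \<partial>lborel) \<le> (\<integral>\<^sup>+x. w x * \<rho> x * indicator ?A x \<partial>lborel)"
      unfolding a .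
  qed measurable
  finally show "radial_energy n p r1 r2 \<phi> \<le> (\<integral>\<^sup>+x. epow (\<rho> x) (P (norm x)) * indicator ?A x \<partial>lborel)" .
qed

end

end

theorem theorem4p3:
  fixes r1 r2 pm pM :: real and p :: "real \<Rightarrow> real"
  assumes "0 < r1" and "r1 < r2"
    and "p \<in> borel_measurable (lebesgue_on {r1<..<r2})"
    and "1 < pm"
    and "\<And>r. r \<in> {r1<..<r2} \<Longrightarrow> pm \<le> p r \<and> p r \<le> pM"
  shows "var_modulus (\<lambda>x::'a::euclidean_space. p (norm x)) (annulus r1 r2) (joining_family r1 r2)
           = (INF \<phi> \<in> radial_class r1 r2. radial_energy DIM('a) p r1 r2 \<phi>)
         \<and> (\<exists>\<phi>0 \<in> radial_class r1 r2.
              radial_energy DIM('a) p r1 r2 \<phi>0 = (INF \<phi> \<in> radial_class r1 r2. radial_energy DIM('a) p r1 r2 \<phi>)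
            \<and> (\<forall>\<phi> \<in> radial_class r1 r2.
                 radial_energy DIM('a) p r1 r2 \<phi> = (INF \<phi> \<in> radial_class r1 r2. radial_energy DIM('a) p r1 r2 \<phi>)
                 \<longrightarrow> (AE r in lebesgue_on {r1..r2}. \<phi> r = \<phi>0 r)))"
proof -
  let ?n = "DIM('a)"
  \<comment> \<open>The bounds at the midpoint of the interval show that the range of exponents is
    nonempty.\<close>
  have pmM: "pm \<le> pM"
    using assms(5)[of "(r1 + r2) / 2"] assms(2) by auto
  obtain P where P [measurable]: "P \<in> borel_measurable borel"
    and P_bounds: "\<And>r. pm \<le> P r \<and> P r \<le> pM"
    and Pp: "AE r in lborel. r \<in> {r1<..<r2} \<longrightarrow> P r = p r"
    using ex_borel_exponent[OF assms(3,5) pmM] by blast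
  \<comment> \<open>The multiplier is sought with \<open>w r = P r * r ^ (?n - 1)\<close> and
    \<open>q r = 1 / (P r - 1)\<close>, the data of the solved Euler--Lagrange equation.\<close>
  have "\<exists>L>0. (\<integral>\<^sup>+r. ennreal ((L / (P r * r ^ (?n - 1))) powr (1 / (P r - 1))) * indicator {r1<..<r2} r \<partial>lborel) = 1"
  proof (rule ex_multiplier)
    \<comment> \<open>\<open>max pM 2\<close> bounds \<open>P r\<close> from above and makes the
      denominator visibly positive.\<close>
    show "0 < r1 ^ (?n - 1)" "0 < 1 / (max pM 2 - 1)" using assms by auto
    fix r assume r: "r \<in> {r1<..<r2}"
    have "1 * r1 ^ (?n - 1) \<le> P r * r ^ (?n - 1)" "P r * r ^ (?n - 1) \<le> pM * r2 ^ (?n - 1)"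
      using r assms P_bounds[of r] by (intro mult_mono power_mono; simp)+
    then show "r1 ^ (?n - 1) \<le> P r * r ^ (?n - 1) \<and> P r * r ^ (?n - 1) \<le> pM * r2 ^ (?n - 1)" by simp
    show "1 / (max pM 2 - 1) \<le> 1 / (P r - 1) \<and> 1 / (P r - 1) \<le> 1 / (pm - 1)"
      using P_bounds[of r] assms(4) by (auto intro!: divide_left_mono)
  qed (use assms in measurable)
  then obtain L where L: "0 < L"
    "(\<integral>\<^sup>+r. ennreal ((L / (P r * r ^ (?n - 1))) powr (1 / (P r - 1))) * indicator {r1<..<r2} r \<partial>lborel) = 1"
    by auto
  define \<phi> where "\<phi> r = (L / (P r * r ^ (?n - 1))) powr (1 / (P r - 1))" for r
  interpret radial_extremal r1 r2 pm pM L P \<phi> ?n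
    using assms L P P_bounds by unfold_locales (auto simp: \<phi>_def[abs_def])
  note phi_class = phi_radial_class[OF Pp]
  have inf: "radial_energy ?n p r1 r2 \<phi> = (INF \<phi> \<in> radial_class r1 r2. radial_energy ?n p r1 r2 \<phi>)"
    by (intro antisym INF_greatest INF_lower radial_energy_phi_le[OF Pp] phi_class)
  moreover have "var_modulus (\<lambda>x::'a. p (norm x)) (annulus r1 r2) (joining_family r1 r2) = radial_energy ?n p r1 r2 \<phi>"
    by (intro antisym var_modulus_le[OF Pp] var_modulus_ge[OF Pp] refl)
  ultimately show ?thesis
    using phi_class radial_minimizer_unique[OF Pp] by (auto intro!: bexI[of _ \<phi>])
qed

end
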